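(* Let $P$ be a simple polygon all of whose interior angles are at least $120^\circ$. Then there is no quadrilateral mesh of $P$ in which every angle of every quadrilateral is less than $120^\circ$.
   Context: A quadrilateral mesh of $P$ is a subdivision of $P$ into quadrilaterals, any two of which are disjoint or meet in a common vertex or a common edge; mesh vertices may lie in the interior of $P$ or on its boundary. *)

theory Defs
  imports "HOL-Analysis.Analysis"
begin

text \<open>Points of the plane are complex numbers. A polygon is given by the cyclic
  list of its vertices.\<close>

definition pv :: "complex list \<Rightarrow> nat \<Rightarrow> complex" where
  "pv vs i = vs ! (i mod length vs)"

definition pedge :: "complex list \<Rightarrow> nat \<Rightarrow> complex set" where
  "pedge vs i = closed_segment (pv vs i) (pv vs (Suc i))"

definition simple_polygon :: "complex list \<Rightarrow> bool" where
  "simple_polygon vs \<longleftrightarrow> length vs \<ge> 3 \<and> distinct vs \<and>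
     (\<forall>i < length vs. \<forall>j < length vs. i \<noteq> j \<longrightarrow>
        (if Suc i mod length vs = j then pedge vs i \<inter> pedge vs j = {pv vs j}
         else if Suc j mod length vs = i then pedge vs i \<inter> pedge vs j = {pv vs i}
         else pedge vs i \<inter> pedge vs j = {}))"

definition poly_boundary :: "complex list \<Rightarrow> complex set" where
  "poly_boundary vs = (\<Union>i < length vs. pedge vs i)"

definition poly_region :: "complex list \<Rightarrow> complex set" where
  "poly_region vs = poly_boundary vs \<union> inside (poly_boundary vs)"

text \<open>Twice the signed (shoelace) area; positive iff the vertices are listed
  counterclockwise.\<close>
definition signed_area2 :: "complex list \<Rightarrow> real" where
  "signed_area2 vs = (\<Sum>i < length vs. Im (cnj (pv vs i) * pv vs (Suc i)))"

definition ccw_angle :: "complex \<Rightarrow> complex \<Rightarrow> real" where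
  "ccw_angle u w = Arg2pi (w / u)"

definition interior_angle :: "complex list \<Rightarrow> nat \<Rightarrow> real" where
  "interior_angle vs i =
     (let v = pv vs i; nxt = pv vs (Suc i); prv = pv vs (i + length vs - 1) in
      if signed_area2 vs > 0 then ccw_angle (nxt - v) (prv - v)
      else ccw_angle (prv - v) (nxt - v))"

definition quad_mesh :: "complex list \<Rightarrow> complex list set \<Rightarrow> bool" where
  "quad_mesh P M \<longleftrightarrow> finite M \<and>
     (\<forall>q \<in> M. length q = 4 \<and> simple_polygon q) \<and>
     (\<Union>q \<in> M. poly_region q) = poly_region P \<and>
     (\<forall>q1 \<in> M. \<forall>q2 \<in> M. q1 \<noteq> q2 \<longrightarrow>
        poly_region q1 \<inter> poly_region q2 = {} \<or>
        (\<exists>v. v \<in> set q1 \<and> v \<in> set q2 \<and> poly_region q1 \<inter> poly_region q2 = {v}) \<or>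
        (\<exists>i < 4. \<exists>j < 4. pedge q1 i = pedge q2 j \<and>
              poly_region q1 \<inter> poly_region q2 = pedge q1 i))"

end

theory Submission
  imports Defs
begin

text \<open>
  Let \<open>V\<close>, \<open>E\<close>, \<open>F\<close> be the numbers of vertices, edges and quadrilaterals of a mesh with all angles
  below \<open>120\<close> degrees, and let \<open>d\<close> quadrilaterals and \<open>e\<close> edges meet at a vertex \<open>v\<close>. Every quadrilateral
  at \<open>v\<close> has a first edge in counterclockwise order and these are distinct, so \<open>d \<le> e\<close>; if \<open>d = e\<close> then
  the angles at \<open>v\<close> add up to a positive multiple of \<open>360\<close> degrees, which forces \<open>d \<ge> 4\<close>. If \<open>d = 1\<close>
  then near \<open>v\<close> the polygon is a sector of less than \<open>120\<close> degrees, which is excluded by the hypothesis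
  on \<open>P\<close>. Hence \<open>d + 4 \<le> 2 e\<close> at every vertex, and summing over all vertices gives \<open>F + V \<le> E\<close>.

  On the other hand \<open>E < F + V\<close>: otherwise some nonzero real 1-cycle on the edges has winding number
  zero in the interior of every quadrilateral. It also has winding number zero outside \<open>P\<close>, so its
  winding number vanishes off the edges; but across an edge it jumps by the weight of that edge.

  Winding numbers are computed as sums of the angles under which the edges are seen. At a corner
  of a simple polygon the limits of this sum along the two sectors differ by \<open>2 \<pi>\<close>, which
  identifies the interior sector up to the orientation. The orientation agrees with the sign of
  the shoelace area because the integral of the visual angle of the segment from \<open>a\<close> to \<open>b\<close> over a large
  disc centred at \<open>0\<close> is a positive constant times the cross product of \<open>a\<close> and \<open>b\<close>.
\<close>

section \<open>Simple polygons as Jordan curves\<close>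

lemma pv_eq_nth: "i < length vs \<Longrightarrow> pv vs i = vs ! i"
  by (simp add: pv_def)

lemma pv_mod: "pv vs (i mod length vs) = pv vs i"
  by (simp add: pv_def)

lemma pv_Suc_mod: "pv vs (Suc i mod length vs) = pv vs (Suc i)"
  by (simp add: pv_def)

lemma pv_length: "pv vs (length vs) = pv vs 0"
  by (simp add: pv_def)

lemma pv_inj:
  assumes "simple_polygon vs" "i < length vs" "j < length vs" "pv vs i = pv vs j"
  shows "i = j"
  using assms by (simp add: simple_polygon_def pv_eq_nth nth_eq_iff_index_eq)

lemma pv_Suc_neq:
  assumes "simple_polygon vs"
  shows "pv vs (Suc i) \<noteq> pv vs i"
proof
  have n: "length vs \<ge> 3" using assms by (simp add: simple_polygon_def)
  assume "pv vs (Suc i) = pv vs i"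
  then have "Suc i mod length vs = i mod length vs"
    using pv_inj[OF assms, of "Suc i mod length vs" "i mod length vs"] n
    by (metis (no_types) assms mod_less_divisor not_numeral_le_zero gr0I pv_mod pv_Suc_mod)
  then show False
    using n by (auto simp: mod_Suc split: if_splits)
qed

lemma pedge_Int:
  assumes "simple_polygon vs" "i < length vs" "j < length vs" "i \<noteq> j"
  shows "pedge vs i \<inter> pedge vs j \<subseteq> {pv vs i, pv vs j}"
  using assms unfolding simple_polygon_def
  by (cases "Suc i mod length vs = j"; cases "Suc j mod length vs = i") auto

section \<open>The polygon boundary as a simple closed path\<close>

text \<open>The base case is already one edge, so stage \<open>k\<close> has \<open>Suc k\<close>
  segments and ends at \<open>v (Suc k)\<close>; no stage is a constant path.\<close>

primrec chain_path :: "(nat \<Rightarrow> complex) \<Rightarrow> nat \<Rightarrow> real \<Rightarrow> complex" where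
  "chain_path v 0 = linepath (v 0) (v 1)"
| "chain_path v (Suc k) = chain_path v k +++ linepath (v (Suc k)) (v (Suc (Suc k)))"

lemma pathstart_chain_path [simp]: "pathstart (chain_path v k) = v 0"
  by (induction k) auto

lemma pathfinish_chain_path [simp]: "pathfinish (chain_path v k) = v (Suc k)"
  by (induction k) auto

lemma path_image_chain_path:
  "path_image (chain_path v k) = (\<Union>i\<le>k. closed_segment (v i) (v (Suc i)))"
  by (induction k) (auto simp: path_image_join atMost_Suc)

text \<open>The strict bound on \<open>Suc k\<close> leaves out the closing edge. Each new edge then
  meets the previous one only in their common vertex and the earlier ones not at all.\<close>

lemma arc_chain_path:
  assumes "simple_polygon vs" "Suc k < length vs"
  shows "arc (chain_path (pv vs) k)"
  using assms(2)
proof (induction k)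
  case 0
  then show ?case using pv_Suc_neq[OF assms(1), of 0] by (auto intro!: arc_linepath)
next
  case (Suc k)
  have "pedge vs i \<inter> pedge vs (Suc k) \<subseteq> {pv vs (Suc k)}" if "i \<le> k" for i
  proof (cases "i = k")
    case True
    then show ?thesis using assms(1) Suc.prems unfolding simple_polygon_def by auto
  next
    case False
    then have "Suc i mod length vs \<noteq> Suc k" "Suc (Suc k) mod length vs \<noteq> i"
      using that Suc.prems by auto
    then show ?thesis using assms(1) Suc.prems that unfolding simple_polygon_def
      by (metis Suc_lessD empty_subsetI le_imp_less_Suc less_irrefl_nat less_trans)
  qed
  then have "path_image (chain_path (pv vs) k) \<inter> pedge vs (Suc k) \<subseteq> {pv vs (Suc k)}"
    by (auto simp: path_image_chain_path pedge_def)
  moreover have "arc (linepath (pv vs (Suc k)) (pv vs (Suc (Suc k))))"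
    using pv_Suc_neq[OF assms(1), of "Suc k"] by (metis arc_linepath)
  ultimately show ?case
    using Suc by (auto intro!: arc_join simp: pedge_def)
qed

lemma simple_polygon_path:
  assumes "simple_polygon vs"
  obtains c where "simple_path c" "pathfinish c = pathstart c" "path_image c = poly_boundary vs"
proof -
  have n: "length vs \<ge> 3" using assms by (simp add: simple_polygon_def)
  \<comment> \<open>The chain up to this \<open>k\<close> runs through all edges except the last
    one, which has index \<open>Suc k\<close> and returns to vertex 0.\<close>
  then obtain k where k: "length vs = Suc (Suc k)"
    by (intro that[of "length vs - 2"]) simp
  let ?c = "chain_path (pv vs) k +++ linepath (pv vs (Suc k)) (pv vs 0)"
  have last: "pedge vs (Suc k) = closed_segment (pv vs (Suc k)) (pv vs 0)"
    using pv_length[of vs] by (simp add: pedge_def k)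
  have "pedge vs i \<inter> pedge vs (Suc k) \<subseteq> {pv vs 0, pv vs (Suc k)}" if "i \<le> k" for i
  proof -
    have "Suc (Suc k) mod length vs = i \<or> Suc i mod length vs = Suc k \<or>
        pedge vs i \<inter> pedge vs (Suc k) = {}"
      using assms that k unfolding simple_polygon_def
      by (metis lessI less_Suc_eq_le less_SucI not_less_eq_eq)
    moreover have "Suc (Suc k) mod length vs = i \<Longrightarrow> i = 0" using k by simp
    moreover have "Suc i mod length vs = Suc k \<Longrightarrow> pedge vs i \<inter> pedge vs (Suc k) = {pv vs (Suc k)}"
      using assms that k unfolding simple_polygon_def
      by (metis lessI less_Suc_eq_le less_SucI not_less_eq_eq)
    ultimately show ?thesis
      using pedge_Int[OF assms, of i "Suc k"] that k by auto
  qed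
  then have int: "path_image (chain_path (pv vs) k) \<inter> pedge vs (Suc k) \<subseteq> {pv vs 0, pv vs (Suc k)}"
    by (auto simp: path_image_chain_path pedge_def)
  have "pv vs (Suc k) \<noteq> pv vs 0"
    using pv_inj[OF assms, of "Suc k" 0] k by auto
  then have "simple_path ?c"
    using arc_chain_path[OF assms, of k] k int last
    by (intro simple_path_join_loop) (auto intro: arc_linepath)
  moreover have "{..<length vs} = insert (Suc k) {..k}" using k by auto
  then have "path_image ?c = poly_boundary vs"
    using pv_length[of vs] k
    by (simp add: poly_boundary_def path_image_join path_image_chain_path pedge_def Un_commute)
  ultimately show ?thesis using that[of ?c] by simp
qed

lemma compact_poly_boundary: "compact (poly_boundary vs)"
  by (auto simp: poly_boundary_def pedge_def)

lemma poly_Jordan: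
  assumes "simple_polygon vs"
  shows "inside (poly_boundary vs) \<noteq> {}" "connected (inside (poly_boundary vs))"
    "bounded (inside (poly_boundary vs))"
    "open (inside (poly_boundary vs))" "open (outside (poly_boundary vs))"
    "connected (outside (poly_boundary vs))"
proof -
  obtain c where c: "simple_path c" "pathfinish c = pathstart c" "path_image c = poly_boundary vs"
    using simple_polygon_path[OF assms] by blast
  note J = Jordan_inside_outside[OF c(1,2), unfolded c(3)]
  show "inside (poly_boundary vs) \<noteq> {}" by (rule J[THEN conjunct1])
  show "open (inside (poly_boundary vs))" by (rule J[THEN conjunct2, THEN conjunct1])
  show "connected (inside (poly_boundary vs))"
    by (rule J[THEN conjunct2, THEN conjunct2, THEN conjunct1])
  show "bounded (inside (poly_boundary vs))"
    by (rule bounded_inside[OF compact_imp_bounded[OF compact_poly_boundary]])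
  show "open (outside (poly_boundary vs))"
    by (rule open_outside[OF compact_imp_closed[OF compact_poly_boundary]])
  show "connected (outside (poly_boundary vs))"
    by (rule connected_outside[OF compact_imp_bounded[OF compact_poly_boundary]]) simp
qed

lemma compl_poly_region: "- poly_region vs = outside (poly_boundary vs)"
  by (simp add: poly_region_def union_with_inside)

lemma closed_poly_region:
  assumes "simple_polygon vs"
  shows "closed (poly_region vs)"
  using poly_Jordan(5)[OF assms] by (simp add: closed_def compl_poly_region)

lemma pedge_subset_boundary: "i < length vs \<Longrightarrow> pedge vs i \<subseteq> poly_boundary vs"
  by (auto simp: poly_boundary_def)

lemma poly_boundary_subset_region: "poly_boundary vs \<subseteq> poly_region vs"
  by (auto simp: poly_region_def)

section \<open>Visual angles and winding numbers\<close>

text \<open>Testing against all potentials \<open>g\<close> says that the boundary of the weighted 1-chain vanishes.\<close>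

definition cycle_weights :: "'x set \<Rightarrow> ('x \<Rightarrow> complex) \<Rightarrow> ('x \<Rightarrow> complex) \<Rightarrow> ('x \<Rightarrow> real) \<Rightarrow> bool" where
  "cycle_weights X a b z \<longleftrightarrow> (\<forall>g :: complex \<Rightarrow> complex. (\<Sum>x\<in>X. z x * (g (b x) - g (a x))) = 0)"

text \<open>The signed angle under which the segment from \<open>a\<close> to \<open>b\<close> is
  seen from \<open>p\<close>, in the principal branch. The cut of \<open>Ln\<close> is met only for
  \<open>p\<close> on the segment itself.\<close>

definition visual_angle :: "complex \<Rightarrow> complex \<Rightarrow> complex \<Rightarrow> real" where
  "visual_angle a b p = Im (Ln ((b - p) / (a - p)))"

text \<open>If the ratio were a real \<open>r\<close> with \<open>r \<le> 0\<close>, then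
  \<open>p\<close> would divide the segment with parameter \<open>1 / (1 - r)\<close>. Off the
  segment the principal logarithm is therefore analytic.\<close>

lemma ratio_notin_nonpos:
  fixes a b p :: complex
  assumes "p \<notin> closed_segment a b"
  shows "(b - p) / (a - p) \<notin> \<real>\<^sub>\<le>\<^sub>0"
proof
  assume "(b - p) / (a - p) \<in> \<real>\<^sub>\<le>\<^sub>0"
  then obtain r where r: "(b - p) / (a - p) = of_real r" "r \<le> 0"
    by (auto elim!: nonpos_Reals_cases)
  have ap: "a - p \<noteq> 0" using assms by auto
  have e: "b - p = of_real r * (a - p)"
    using nonzero_eq_divide_eq[THEN iffD1, OF ap r(1)[symmetric]] by (rule sym)
  define t where "t = 1 / (1 - r)"
  have "1 - r > 0" using r(2) by simp
  then have t: "0 \<le> t" "t \<le> 1" "1 - t = - r * t"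
    using r(2) unfolding t_def by (simp, simp add: divide_le_eq, simp add: divide_simps)
  have "(1 - t) *\<^sub>R (a - p) + t *\<^sub>R (b - p) = 0"
  proof -
    have "(1 - t) *\<^sub>R (a - p) + t *\<^sub>R (b - p) = (1 - t + t * r) *\<^sub>R (a - p)"
      unfolding e by (simp add: scaleR_conv_of_real algebra_simps)
    then show ?thesis using t(3) by simp
  qed
  then have "p = (1 - t) *\<^sub>R a + t *\<^sub>R b"
    by (simp add: algebra_simps)
  then show False using assms t by (auto simp: in_segment)
qed

lemma abs_visual_angle_less_pi: "p \<notin> closed_segment a b \<Longrightarrow> \<bar>visual_angle a b p\<bar> < pi"
  unfolding visual_angle_def using Im_Ln_less_pi[OF ratio_notin_nonpos[of p a b]]
    mpi_less_Im_Ln[of "(b - p) / (a - p)"]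
  by (cases "a=p"; cases "b=p") auto

lemma isCont_visual_angle:
  assumes "p \<notin> closed_segment a b"
  shows "isCont (visual_angle a b) p"
proof -
  have "a \<noteq> p" using assms by auto
  then have "isCont (\<lambda>p. Im (Ln ((b - p) / (a - p)))) p"
    using ratio_notin_nonpos[OF assms] by (intro isCont_Im isCont_Ln' isCont_divide isCont_diff continuous_const continuous_ident) auto
  then show ?thesis by (simp add: visual_angle_def[abs_def])
qed

text \<open>The derivative of each logarithm is the difference of the values at \<open>b x\<close>
  and \<open>a x\<close> of the potential sending \<open>q\<close> to \<open>- 1 / (q - p)\<close>.
  Testing the cycle against this potential makes the total derivative vanish.\<close>

lemma cycle_Ln_const:
  fixes S :: "complex set"
  assumes cyc: "cycle_weights X a b z"
    and S: "open S" "connected S" "\<And>x. x \<in> X \<Longrightarrow> S \<inter> closed_segment (a x) (b x) = {}"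
  shows "(\<lambda>p. \<Sum>x\<in>X. z x * Ln ((b x - p) / (a x - p))) constant_on S"
proof (rule has_field_derivative_0_imp_constant_on[OF _ S(2,1)])
  fix p assume p: "p \<in> S"
  have "((\<lambda>p. \<Sum>x\<in>X. z x * Ln ((b x - p) / (a x - p))) has_field_derivative
      (\<Sum>x\<in>X. z x * (- inverse (b x - p) - - inverse (a x - p)))) (at p)"
  proof (intro DERIV_sum DERIV_cmult)
    fix x assume x: "x \<in> X"
    have np: "p \<notin> closed_segment (a x) (b x)" using S(3)[OF x] p by auto
    then have ne: "a x \<noteq> p" "b x \<noteq> p" by auto
    show "((\<lambda>p. Ln ((b x - p) / (a x - p))) has_field_derivative
      - inverse (b x - p) - - inverse (a x - p)) (at p)"
      using ratio_notin_nonpos[OF np] ne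
      by (auto intro!: derivative_eq_intros simp: divide_simps)
  qed
  moreover have "(\<Sum>x\<in>X. z x * (- inverse (b x - p) - - inverse (a x - p))) = 0"
    using cyc[unfolded cycle_weights_def, rule_format, of "\<lambda>q. - inverse (q - p)"] by simp
  ultimately show "((\<lambda>p. \<Sum>x\<in>X. z x * Ln ((b x - p) / (a x - p))) has_field_derivative 0) (at p)"
    by simp
qed

lemma Im_cycle_Ln:
  "Im (\<Sum>x\<in>X. of_real (z x) * Ln ((b x - p) / (a x - p))) = (\<Sum>x\<in>X. z x * visual_angle (a x) (b x) p)"
  by (simp add: visual_angle_def)

lemma cycle_angle_const:
  assumes "cycle_weights X a b z" "open S" "connected S"
    "\<And>x. x \<in> X \<Longrightarrow> S \<inter> closed_segment (a x) (b x) = {}"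
  shows "(\<lambda>p. \<Sum>x\<in>X. z x * visual_angle (a x) (b x) p) constant_on S"
  using cycle_Ln_const[OF assms] unfolding constant_on_def Im_cycle_Ln[symmetric] by metis

text \<open>The ratio equals \<open>1 + (b - a) / (a - p)\<close>, which tends to 1.\<close>

lemma visual_angle_at_infinity: "(visual_angle a b \<longlongrightarrow> 0) at_infinity"
proof -
  have "((\<lambda>p. (b - a) * inverse (a - p)) \<longlongrightarrow> (b - a) * 0) at_infinity"
  proof (intro tendsto_intros filterlim_compose[OF tendsto_inverse_0])
    have "filterlim (\<lambda>p::complex. - p) at_infinity at_infinity"
      by (auto simp: filterlim_at_infinity[of 0] eventually_at_infinity)
    then show "filterlim (\<lambda>p. a - p) at_infinity at_infinity"
      using tendsto_add_filterlim_at_infinity[OF tendsto_const[of a at_infinity],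
          of "\<lambda>p. - p"] by simp
  qed
  then have "((\<lambda>p. 1 + (b - a) * inverse (a - p)) \<longlongrightarrow> 1 + (b - a) * 0) at_infinity"
    by (rule tendsto_add[OF tendsto_const])
  then have "((\<lambda>p. 1 + (b - a) * inverse (a - p)) \<longlongrightarrow> 1) at_infinity" by simp
  then have "((\<lambda>p. (b - p) / (a - p)) \<longlongrightarrow> 1) at_infinity"
  proof (rule Lim_transform_eventually)
    show "\<forall>\<^sub>F p in at_infinity. 1 + (b - a) * inverse (a - p) = (b - p) / (a - p)"
      using eventually_not_equal_at_infinity[of a]
      by eventually_elim (auto simp: field_simps)
  qed
  then have "((\<lambda>p. Im (Ln ((b - p) / (a - p)))) \<longlongrightarrow> Im (Ln 1)) at_infinity"
    by (intro tendsto_Im tendsto_Ln) auto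
  then show ?thesis unfolding visual_angle_def by simp
qed

text \<open>The angle sum is constant on \<open>S\<close>, and \<open>S\<close> reaches infinity,
  where every summand tends to 0.\<close>

lemma cycle_angle_zero:
  assumes "cycle_weights X a b z" "open S" "connected S"
    "\<And>x. x \<in> X \<Longrightarrow> S \<inter> closed_segment (a x) (b x) = {}"
    and inf: "bounded (- S)" and p: "p \<in> S"
  shows "(\<Sum>x\<in>X. z x * visual_angle (a x) (b x) p) = 0"
proof -
  let ?f = "\<lambda>p. \<Sum>x\<in>X. z x * visual_angle (a x) (b x) p"
  obtain c where c: "\<And>q. q \<in> S \<Longrightarrow> ?f q = c"
    using cycle_angle_const[OF assms(1-4)] by (auto simp: constant_on_def)
  have "(?f \<longlongrightarrow> (\<Sum>x\<in>X. z x * 0)) at_infinity"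
    by (intro tendsto_intros visual_angle_at_infinity)
  moreover obtain B where "\<And>q. q \<notin> S \<Longrightarrow> norm q \<le> B"
    using inf by (auto simp: bounded_iff)
  then have "\<forall>\<^sub>F q in at_infinity. q \<in> S"
    unfolding eventually_at_infinity by (intro exI[of _ "B + 1"]) force
  then have "\<forall>\<^sub>F q in at_infinity. ?f q = c"
    by eventually_elim (rule c)
  ultimately have "((\<lambda>q. c) \<longlongrightarrow> 0) (at_infinity :: complex filter)"
    by (simp add: tendsto_cong)
  then have "c = 0"
    using tendsto_const_iff[OF trivial_limit_at_infinity] by blast
  then show ?thesis using c[OF p] by simp
qed

text \<open>Off the boundary this is \<open>2 * pi\<close> times the winding number of the polygon
  around \<open>p\<close>.\<close>

definition poly_angle :: "complex list \<Rightarrow> complex \<Rightarrow> real" where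
  "poly_angle vs p = (\<Sum>i<length vs. visual_angle (pv vs i) (pv vs (Suc i)) p)"

lemma cycle_weights_polygon: "cycle_weights {..<length vs} (pv vs) (\<lambda>i. pv vs (Suc i)) (\<lambda>_. 1)"
  unfolding cycle_weights_def
  using sum_lessThan_telescope[of "\<lambda>i. g (pv vs i)" "length vs" for g :: "complex \<Rightarrow> complex"]
  by (simp add: pv_length)

lemma poly_angle_outside:
  assumes "simple_polygon vs" "p \<in> outside (poly_boundary vs)"
  shows "poly_angle vs p = 0"
proof -
  have "bounded (- outside (poly_boundary vs))"
    using poly_Jordan(3)[OF assms(1)] compact_imp_bounded[OF compact_poly_boundary]
    by (simp add: compl_poly_region[symmetric] poly_region_def)
  moreover have "outside (poly_boundary vs) \<inter> closed_segment (pv vs i) (pv vs (Suc i)) = {}"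
    if "i \<in> {..<length vs}" for i
    using outside_no_overlap[of "poly_boundary vs"] pedge_subset_boundary[of i vs] that
    unfolding pedge_def by blast
  ultimately show ?thesis
    using cycle_angle_zero[OF cycle_weights_polygon poly_Jordan(5,6)[OF assms(1)] _ _ assms(2)]
    unfolding poly_angle_def by simp
qed

text \<open>The constant stays unspecified here; the behaviour at a corner shows later that it is
  \<open>2 * pi\<close> or \<open>- 2 * pi\<close>.\<close>

lemma poly_angle_inside:
  assumes "simple_polygon vs"
  obtains c where "\<And>p. p \<in> inside (poly_boundary vs) \<Longrightarrow> poly_angle vs p = c"
proof -
  have "inside (poly_boundary vs) \<inter> closed_segment (pv vs i) (pv vs (Suc i)) = {}"
    if "i \<in> {..<length vs}" for i
    using inside_no_overlap[of "poly_boundary vs"] pedge_subset_boundary[of i vs] that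
    unfolding pedge_def by blast
  then have "poly_angle vs constant_on inside (poly_boundary vs)"
    using cycle_angle_const[OF cycle_weights_polygon poly_Jordan(4,2)[OF assms], of vs]
    unfolding poly_angle_def[abs_def] by simp
  then show ?thesis using that by (auto simp: constant_on_def)
qed

section \<open>Corners of simple polygons\<close>

lemma pv_pred_mod:
  "i < length vs \<Longrightarrow> pv vs ((i + length vs - 1) mod length vs) = pv vs (i + length vs - 1)"
  by (simp add: pv_mod)

lemma Suc_pred_mod:
  assumes "i < n"
  shows "Suc ((i + n - 1) mod n) mod n = (i :: nat)"
  using assms by (simp add: mod_Suc_eq)

lemma pred_mod_eq:
  assumes "j < n" "Suc j mod n = i"
  shows "j = (i + n - 1) mod (n :: nat)"
  using assms by (cases "Suc j = n") auto

text \<open>Vertex \<open>i\<close> also lies on edge \<open>i\<close>. A nonadjacent edge is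
  disjoint from edge \<open>i\<close>, and the following edge meets it only in the next
  vertex.\<close>

lemma vertex_in_pedge:
  assumes vs: "simple_polygon vs" and ij: "i < length vs" "j < length vs" "pv vs i \<in> pedge vs j"
  shows "j = i \<or> j = (i + length vs - 1) mod length vs"
proof (rule ccontr)
  assume c: "\<not> ?thesis"
  have "pv vs i \<in> pedge vs i" by (simp add: pedge_def)
  then have *: "pv vs i \<in> pedge vs i \<inter> pedge vs j" using ij(3) by blast
  have "Suc j mod length vs \<noteq> i" using c pred_mod_eq[OF ij(2)] by auto
  moreover have "Suc i mod length vs \<noteq> j"
  proof
    assume s: "Suc i mod length vs = j"
    then have "pedge vs i \<inter> pedge vs j = {pv vs j}"
      using vs ij c unfolding simple_polygon_def by auto
    then have "i = j" using * pv_inj[OF vs ij(1,2)] by auto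
    then show False using c by simp
  qed
  ultimately have "pedge vs i \<inter> pedge vs j = {}"
    using vs ij c unfolding simple_polygon_def by auto
  then show False using * by blast
qed

section \<open>Arithmetic of counterclockwise angles\<close>

lemma Arg2pi_cis: "0 \<le> x \<Longrightarrow> x < 2 * pi \<Longrightarrow> Arg2pi (cis x) = x"
  by (rule Arg2pi_unique[of 1]) (auto simp: cis_conv_exp)

lemma Arg2pi_inverse_pos:
  assumes "0 < Arg2pi z"
  shows "Arg2pi (inverse z) = 2 * pi - Arg2pi z"
  using assms Arg2pi_eq_0_pi[of z] by (auto simp: Arg2pi_inverse)

lemma Arg2pi_quotient:
  assumes "x \<noteq> 0" "y \<noteq> 0"
  shows "Arg2pi (x / y) = (if Arg2pi y \<le> Arg2pi x then Arg2pi x - Arg2pi y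
    else Arg2pi x - Arg2pi y + 2 * pi)"
proof (cases "Arg2pi y \<le> Arg2pi x")
  case True
  then show ?thesis using Arg2pi_divide[OF assms(2,1)] by simp
next
  case False
  then have "Arg2pi (y / x) = Arg2pi y - Arg2pi x"
    using Arg2pi_divide[OF assms(1,2)] by simp
  then show ?thesis using False Arg2pi_inverse_pos[of "y / x"] by simp
qed

lemma Arg2pi_pos_iff: "z \<noteq> 0 \<Longrightarrow> 0 < Arg2pi z \<longleftrightarrow> - z \<notin> \<real>\<^sub>\<le>\<^sub>0"
  using Arg2pi_ge_0[of z] Arg2pi_eq_0[of z]
  by (auto simp: complex_nonpos_Reals_iff complex_is_Real_iff less_le)

lemma Im_Ln_scale: "0 < r \<Longrightarrow> z \<noteq> 0 \<Longrightarrow> Im (Ln (of_real r * z)) = Im (Ln z)"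
  using Arg_times_of_real[of r z] Arg_eq_Im_Ln[of z] Arg_eq_Im_Ln[of "of_real r * z"] by simp

section \<open>Visual angles of an edge near one of its ends\<close>

text \<open>Seen from \<open>v + t n\<close>, the ratio is \<open>t\<close> times
  \<open>- n / (w - t n)\<close>. The positive factor does not change the argument, and the rest
  tends to \<open>- n / w\<close>, which is off the cut because \<open>n\<close> does not point
  along \<open>w\<close>.\<close>

lemma visual_angle_limit_to_vertex:
  assumes "w \<noteq> 0" "n \<noteq> 0" "0 < Arg2pi (n / w)"
  shows "((\<lambda>t. visual_angle (v + w) v (v + of_real t * n)) \<longlongrightarrow> Arg2pi (n / w) - pi) (at_right 0)"
proof -
  have np: "- n / w \<notin> \<real>\<^sub>\<le>\<^sub>0"
    using Arg2pi_pos_iff[of "n / w"] assms by simp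
  have "((\<lambda>t::real. Im (Ln (- n / (w - of_real t * n)))) \<longlongrightarrow> Im (Ln (- n / (w - of_real 0 * n)))) (at_right 0)"
    using np assms by (intro tendsto_intros) auto
  then have lim: "((\<lambda>t::real. Im (Ln (- n / (w - of_real t * n)))) \<longlongrightarrow> Arg2pi (n / w) - pi) (at_right 0)"
    using Arg2pi_Ln[OF assms(3)] by simp
  have "\<forall>\<^sub>F t in at_right (0::real). w - of_real t * n \<noteq> 0"
  proof (rule tendsto_imp_eventually_ne)
    show "((\<lambda>t::real. w - of_real t * n) \<longlongrightarrow> w - of_real 0 * n) (at_right 0)"
      by (intro tendsto_intros)
  qed (use assms in auto)
  then have "\<forall>\<^sub>F t in at_right (0::real). Im (Ln (- n / (w - of_real t * n))) =
      visual_angle (v + w) v (v + of_real t * n)"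
    using eventually_at_right_less[of "0::real"]
  proof eventually_elim
    case (elim t)
    have "(v - (v + of_real t * n)) / (v + w - (v + of_real t * n)) = of_real t * (- n / (w - of_real t * n))"
      by simp
    then show ?case
      using Im_Ln_scale[of t "- n / (w - of_real t * n)"] elim assms(2) by (simp only: visual_angle_def) simp
  qed
  with lim show ?thesis by (rule Lim_transform_eventually)
qed

lemma visual_angle_swap:
  assumes "p \<notin> closed_segment a b"
  shows "visual_angle b a p = - visual_angle a b p"
  using Ln_inverse[OF ratio_notin_nonpos[OF assms]] by (simp add: visual_angle_def)

lemma ray_not_in_segment:
  assumes "u \<noteq> 0" "n \<noteq> 0" "0 < Arg2pi (n / u)" "t > 0"
  shows "v + of_real t * n \<notin> closed_segment (v + u) v"
proof
  assume "v + of_real t * n \<in> closed_segment (v + u) v"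
  then obtain s where s: "0 \<le> s" "v + of_real t * n = (1 - s) *\<^sub>R v + s *\<^sub>R (v + u)"
    unfolding closed_segment_commute[of "v + u"] in_segment by blast
  then have "of_real t * n = of_real s * u" by (simp add: scaleR_conv_of_real algebra_simps)
  then have "n / u = of_real (s / t)" using assms by (simp add: field_simps)
  then have "Arg2pi (n / u) = 0" using s(1) assms(4) by (simp add: Arg2pi_of_real not_less del: of_real_divide)
  then show False using assms by simp
qed

lemma visual_angle_limit_from_vertex:
  assumes "u \<noteq> 0" "n \<noteq> 0" "0 < Arg2pi (n / u)"
  shows "((\<lambda>t. visual_angle v (v + u) (v + of_real t * n)) \<longlongrightarrow> pi - Arg2pi (n / u)) (at_right 0)"
proof -
  have "\<forall>\<^sub>F t in at_right (0::real). - visual_angle (v + u) v (v + of_real t * n) =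
      visual_angle v (v + u) (v + of_real t * n)"
    using eventually_at_right_less[of "0::real"]
    by eventually_elim (use ray_not_in_segment[OF assms] visual_angle_swap in simp)
  moreover have "((\<lambda>t. - visual_angle (v + u) v (v + of_real t * n)) \<longlongrightarrow> - (Arg2pi (n / u) - pi)) (at_right 0)"
    by (intro tendsto_minus visual_angle_limit_to_vertex assms)
  ultimately show ?thesis using Lim_transform_eventually by fastforce
qed

text \<open>The other values in \<open>S\<close> form a closed set, which the function eventually
  avoids. This turns limits of angle sums into exact values.\<close>

lemma tendsto_finite_range:
  fixes f :: "'a \<Rightarrow> real"
  assumes "finite S" "F \<noteq> bot" "\<forall>\<^sub>F x in F. f x \<in> S" "(f \<longlongrightarrow> l) F"
  shows "l \<in> S" "\<forall>\<^sub>F x in F. f x = l"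
proof -
  have "\<forall>\<^sub>F x in F. f x \<in> - (S - {l})"
    using assms(1) by (intro topological_tendstoD[OF assms(4)] open_Compl finite_imp_closed) auto
  with assms(3) show *: "\<forall>\<^sub>F x in F. f x = l"
    by eventually_elim auto
  with assms(3) have "\<forall>\<^sub>F x in F. l \<in> S"
    by eventually_elim auto
  then show "l \<in> S" using assms(2) by (simp add: eventually_const)
qed

section \<open>Angle sums along the rays leaving a corner\<close>

context
  fixes vs :: "complex list" and i k :: nat and v u w :: complex
  assumes vs: "simple_polygon vs" and i: "i < length vs"
    and v: "v = pv vs i" and u: "u = pv vs (Suc i) - v" and w: "w = pv vs (i + length vs - 1) - v"
    and k: "k = (i + length vs - 1) mod length vs"
begin

lemma prev_edge: "k < length vs" "k \<noteq> i" "pv vs k = v + w"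
  "pv vs (Suc k) = v"
proof -
  have n: "length vs \<ge> 3" using vs by (simp add: simple_polygon_def)
  then show "k < length vs" unfolding k by (intro mod_less_divisor) linarith
  show "k \<noteq> i" using n i unfolding k
    by (cases i) auto
  show "pv vs k = v + w" using i unfolding k by (simp only: pv_pred_mod w) simp
  show "pv vs (Suc k) = v"
    using Suc_pred_mod[OF i] pv_Suc_mod[of vs k] v by (metis k)
qed

lemma corner_nonzero: "u \<noteq> 0" "w \<noteq> 0"
  using pv_Suc_neq[OF vs, of i] pv_Suc_neq[OF vs, of k] prev_edge(3,4) u v by auto

text \<open>With angle 0 both edges would leave \<open>v\<close> in the same direction and share the
  point \<open>v + m u\<close>, where \<open>m = min 1 r\<close> is short enough for both. Adjacent
  edges share only their vertex.\<close>

lemma corner_angle_pos: "0 < Arg2pi (w / u)"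
proof (rule ccontr)
  assume "\<not> ?thesis"
  then have "Arg2pi (w / u) = 0" using Arg2pi_ge_0[of "w / u"] by simp
  then obtain r where r: "w / u = of_real r" "r \<ge> 0"
    by (auto simp: Arg2pi_eq_0 elim!: Reals_cases)
  then have wr: "w = r *\<^sub>R u" using corner_nonzero by (simp add: field_simps scaleR_conv_of_real)
  then have r0: "r > 0" using r(2) corner_nonzero by (cases "r = 0") auto
  define m where "m = min 1 r"
  have m: "0 < m" "m \<le> 1" "m \<le> r" using r0 by (auto simp: m_def)
  have "v + m *\<^sub>R u \<in> closed_segment v (v + u)"
    using m unfolding in_segment by (intro exI[of _ m]) (auto simp: algebra_simps)
  moreover have "v + m *\<^sub>R u \<in> closed_segment v (v + w)"
    using m r0 unfolding in_segment wr by (intro exI[of _ "m / r"]) (auto simp: algebra_simps)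
  ultimately have "v + m *\<^sub>R u \<in> pedge vs i \<inter> pedge vs k"
    unfolding pedge_def prev_edge using u v by (simp add: closed_segment_commute)
  moreover have "pedge vs k \<inter> pedge vs i = {pv vs i}"
    using vs i prev_edge(1,2) Suc_pred_mod[OF i, folded k] unfolding simple_polygon_def by auto
  ultimately have "v + m *\<^sub>R u = v" using v by blast
  then show False using m(1) corner_nonzero by simp
qed

text \<open>The two edges at the corner contribute \<open>pi - Arg2pi (n / u)\<close> and
  \<open>Arg2pi (n / w) - pi\<close>. In the sum, \<open>n\<close> survives only through the side of
  \<open>w\<close> on which it lies. All other edges miss \<open>v\<close>, so their visual angles
  are continuous there.\<close>

lemma corner_limit:
  assumes n: "n \<noteq> 0" "0 < Arg2pi (n / u)" "Arg2pi (n / u) \<noteq> Arg2pi (w / u)"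
  shows "\<forall>\<^sub>F t in at_right 0. v + of_real t * n \<notin> poly_boundary vs"
    and "((\<lambda>t. poly_angle vs (v + of_real t * n)) \<longlongrightarrow>
      (\<Sum>j\<in>{..<length vs} - {i, k}. visual_angle (pv vs j) (pv vs (Suc j)) v)
        + (if Arg2pi (n / u) < Arg2pi (w / u) then 2 * pi else 0) - Arg2pi (w / u)) (at_right 0)"
proof -
  have nw: "Arg2pi (n / w) = Arg2pi (n / u) - Arg2pi (w / u) +
      (if Arg2pi (n / u) < Arg2pi (w / u) then 2 * pi else 0)"
    using Arg2pi_quotient[of "n / u" "w / u"] corner_nonzero n by auto
  then have nw0: "0 < Arg2pi (n / w)"
    using n Arg2pi_ge_0[of "n / u"] Arg2pi_lt_2pi[of "w / u"] by auto
  have tt: "((\<lambda>t::real. v + of_real t * n) \<longlongrightarrow> v) (at_right 0)"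
    by (rule tendsto_eq_intros refl | simp)+
  have off: "v \<notin> pedge vs j" if "j \<in> {..<length vs} - {i, k}" for j
    using vertex_in_pedge[OF vs i, of j, folded k] that v by auto
  have pi: "pedge vs i = closed_segment (v + u) v" "pedge vs k = closed_segment (v + w) v"
    using u v by (simp_all add: pedge_def prev_edge closed_segment_commute)
  have "\<forall>\<^sub>F t in at_right 0. v + of_real t * n \<notin> pedge vs j" if j: "j \<in> {..<length vs}" for j
  proof (cases "j \<in> {i, k}")
    case True
    then show ?thesis
      using eventually_at_right_less[of "0::real"] pi ray_not_in_segment[OF corner_nonzero(1) n(1,2)]
        ray_not_in_segment[OF corner_nonzero(2) n(1) nw0]
      by (auto elim!: eventually_mono)
  next
    case False
    have "open (- pedge vs j)" unfolding pedge_def by (intro open_Compl closed_segment)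
    then show ?thesis using topological_tendstoD[OF tt, of "- pedge vs j"] off[of j] False j by simp
  qed
  then have "\<forall>\<^sub>F t in at_right 0. \<forall>j\<in>{..<length vs}. v + of_real t * n \<notin> pedge vs j"
    by (simp add: eventually_ball_finite)
  then show "\<forall>\<^sub>F t in at_right 0. v + of_real t * n \<notin> poly_boundary vs"
    by eventually_elim (auto simp: poly_boundary_def)
  let ?R = "{..<length vs} - {i, k}"
  have split: "poly_angle vs p = (\<Sum>j\<in>?R. visual_angle (pv vs j) (pv vs (Suc j)) p)
      + visual_angle v (v + u) p + visual_angle (v + w) v p" for p
  proof -
    have "poly_angle vs p = (\<Sum>j\<in>?R. visual_angle (pv vs j) (pv vs (Suc j)) p)
        + (\<Sum>j\<in>{i, k}. visual_angle (pv vs j) (pv vs (Suc j)) p)"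
      unfolding poly_angle_def using i prev_edge(1) by (intro sum.subset_diff) auto
    then show ?thesis using prev_edge(2)[symmetric] prev_edge(3,4) u v by simp
  qed
  have "((\<lambda>t. poly_angle vs (v + of_real t * n)) \<longlongrightarrow>
      (\<Sum>j\<in>?R. visual_angle (pv vs j) (pv vs (Suc j)) v) + (pi - Arg2pi (n / u)) + (Arg2pi (n / w) - pi)) (at_right 0)"
    unfolding split
  proof (intro tendsto_add tendsto_sum visual_angle_limit_from_vertex visual_angle_limit_to_vertex
      corner_nonzero n nw0)
    fix j assume "j \<in> ?R"
    then show "((\<lambda>t. visual_angle (pv vs j) (pv vs (Suc j)) (v + of_real t * n)) \<longlongrightarrow>
        visual_angle (pv vs j) (pv vs (Suc j)) v) (at_right 0)"
      using isCont_tendsto_compose[OF isCont_visual_angle tt] off[of j] by (simp add: pedge_def)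
  qed
  then show "((\<lambda>t. poly_angle vs (v + of_real t * n)) \<longlongrightarrow>
      (\<Sum>j\<in>?R. visual_angle (pv vs j) (pv vs (Suc j)) v)
        + (if Arg2pi (n / u) < Arg2pi (w / u) then 2 * pi else 0) - Arg2pi (w / u)) (at_right 0)"
    using nw by (simp add: algebra_simps)
qed

text \<open>Along each of the two sectors the angle sum tends to \<open>0\<close> or \<open>C\<close>, and the two limits differ
  by \<open>2 \<pi>\<close>. This determines \<open>C\<close> up to its sign, and the sign determines which sector is inside.\<close>

lemma corner_dichotomy:
  assumes C: "\<And>p. p \<in> inside (poly_boundary vs) \<Longrightarrow> poly_angle vs p = C"
  shows "(C = 2 * pi \<and>
      (\<forall>n. n \<noteq> 0 \<and> 0 < Arg2pi (n / u) \<and> Arg2pi (n / u) < Arg2pi (w / u) \<longrightarrow>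
        (\<forall>\<^sub>F t in at_right 0. v + of_real t * n \<in> inside (poly_boundary vs))) \<and>
      (\<forall>n. n \<noteq> 0 \<and> Arg2pi (w / u) < Arg2pi (n / u) \<longrightarrow>
        (\<forall>\<^sub>F t in at_right 0. v + of_real t * n \<in> outside (poly_boundary vs)))) \<or>
    (C = - 2 * pi \<and>
      (\<forall>n. n \<noteq> 0 \<and> 0 < Arg2pi (n / u) \<and> Arg2pi (n / u) < Arg2pi (w / u) \<longrightarrow>
        (\<forall>\<^sub>F t in at_right 0. v + of_real t * n \<in> outside (poly_boundary vs))) \<and>
      (\<forall>n. n \<noteq> 0 \<and> Arg2pi (w / u) < Arg2pi (n / u) \<longrightarrow>
        (\<forall>\<^sub>F t in at_right 0. v + of_real t * n \<in> inside (poly_boundary vs))))"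
proof -
  let ?I = "inside (poly_boundary vs)" and ?O = "outside (poly_boundary vs)"
  let ?\<alpha> = "Arg2pi (w / u)"
  define L where "L = (\<Sum>j\<in>{..<length vs} - {i, k}. visual_angle (pv vs j) (pv vs (Suc j)) v)"
  have io: "p \<in> ?I \<or> p \<in> ?O" if "p \<notin> poly_boundary vs" for p
    using that inside_Un_outside[of "poly_boundary vs"] by blast
  have *: "l \<in> {0, C}" "\<forall>\<^sub>F t in at_right 0. poly_angle vs (v + of_real t * n) = l"
    if n: "n \<noteq> 0" "0 < Arg2pi (n / u)" "Arg2pi (n / u) \<noteq> ?\<alpha>"
      and l: "l = L + (if Arg2pi (n / u) < ?\<alpha> then 2 * pi else 0) - ?\<alpha>" for n l
  proof -
    have "\<forall>\<^sub>F t in at_right 0. poly_angle vs (v + of_real t * n) \<in> {0, C}"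
      using corner_limit(1)[OF n]
      by eventually_elim (use io C poly_angle_outside[OF vs] in blast)
    then show "l \<in> {0, C}" "\<forall>\<^sub>F t in at_right 0. poly_angle vs (v + of_real t * n) = l"
      using tendsto_finite_range[of "{0, C}" "at_right (0::real)", OF _ _ _ corner_limit(2)[OF n]] l L_def
      by auto
  qed
  have a: "0 < ?\<alpha>" "?\<alpha> < 2 * pi" using corner_angle_pos Arg2pi_lt_2pi by auto
  have "Arg2pi (u * cis x / u) = x" "u * cis x \<noteq> 0" if "0 \<le> x" "x < 2 * pi" for x
    using corner_nonzero Arg2pi_cis[OF that] by auto
  \<comment> \<open>The bisector of each of the two sectors serves as a test direction.\<close>
  then have l1: "L + 2 * pi - ?\<alpha> \<in> {0, C}" and l2: "L - ?\<alpha> \<in> {0, C}"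
    using *(1)[of "u * cis (?\<alpha> / 2)", OF _ _ _ refl]
      *(1)[of "u * cis ((?\<alpha> + 2 * pi) / 2)", OF _ _ _ refl] a corner_nonzero(1) by simp_all
  have dir1: "\<forall>\<^sub>F t in at_right 0. v + of_real t * n \<notin> poly_boundary vs \<and> poly_angle vs (v + of_real t * n) = L + 2 * pi - ?\<alpha>"
    if "n \<noteq> 0 \<and> 0 < Arg2pi (n / u) \<and> Arg2pi (n / u) < ?\<alpha>" for n
    using *(2)[of n] corner_limit(1)[of n] that by (simp add: eventually_conj_iff)
  have dir2: "\<forall>\<^sub>F t in at_right 0. v + of_real t * n \<notin> poly_boundary vs \<and> poly_angle vs (v + of_real t * n) = L - ?\<alpha>"
    if "n \<noteq> 0 \<and> ?\<alpha> < Arg2pi (n / u)" for n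
    using *(2)[of n] corner_limit(1)[of n] that a by (simp add: eventually_conj_iff)
  have toI: "p \<in> ?I" if "p \<notin> poly_boundary vs \<and> poly_angle vs p = C" "C \<noteq> 0" for p
    using that io[of p] poly_angle_outside[OF vs, of p] by auto
  have toO: "p \<in> ?O" if "p \<notin> poly_boundary vs \<and> poly_angle vs p = 0" "C \<noteq> 0" for p
    using that io[of p] C[of p] by auto
  \<comment> \<open>Two members of \<open>{0, C}\<close> differ by \<open>2 * pi\<close>, so one of
    them is 0 and the other is \<open>C\<close>.\<close>
  consider "C = 2 * pi" "L + 2 * pi - ?\<alpha> = C" "L - ?\<alpha> = 0"
    | "C = - 2 * pi" "L + 2 * pi - ?\<alpha> = 0" "L - ?\<alpha> = C"
    using l1 l2 pi_gt_zero by force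
  then show ?thesis
  proof cases
    case 1
    then show ?thesis
      using dir1 dir2 toI toO
      by (intro disjI1 conjI allI impI) (simp, (force elim!: eventually_mono)+)
  next
    case 2
    then show ?thesis
      using dir1 dir2 toI toO
      by (intro disjI2 conjI allI impI) (simp, (force elim!: eventually_mono)+)
  qed
qed

end

section \<open>Orientation and signed area\<close>

definition to_complex :: "real^2 \<Rightarrow> complex" where
  "to_complex x = Complex (x $ 1) (x $ 2)"

definition of_complex :: "complex \<Rightarrow> real^2" where
  "of_complex z = vector [Re z, Im z]"

lemma to_of_complex [simp]: "to_complex (of_complex z) = z"
  by (simp add: to_complex_def of_complex_def)

lemma of_to_complex [simp]: "of_complex (to_complex x) = x"
  by (simp add: to_complex_def of_complex_def vec_eq_iff forall_2)

lemma linear_to_complex: "linear to_complex"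
  by (rule linearI) (simp_all add: to_complex_def complex_eq_iff)

lemma linear_of_complex: "linear of_complex"
  by (rule linearI) (simp_all add: of_complex_def vec_eq_iff forall_2)

lemma inj_to_complex: "inj to_complex"
  by (metis injI of_to_complex)

lemma norm_to_complex [simp]: "norm (to_complex x) = norm x"
  by (simp add: to_complex_def cmod_def norm_vec_def L2_set_def sum_2)

lemma norm_of_complex [simp]: "norm (of_complex x) = norm x"
  by (metis norm_to_complex to_of_complex)

lemma continuous_to_complex: "continuous_on S to_complex"
  by (rule linear_continuous_on) (simp add: linear_to_complex linear_conv_bounded_linear[symmetric])

lemma to_complex_in_segment:
  "to_complex x \<in> closed_segment a b \<longleftrightarrow> x \<in> closed_segment (of_complex a) (of_complex b)"
  using closed_segment_linear_image[OF linear_to_complex, of "of_complex a" "of_complex b"]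
    inj_image_mem_iff[OF inj_to_complex] by simp

lemma negligible_closed_segment: "negligible (closed_segment a (b :: real^2))"
  by (simp add: negligible_convex_interior interior_closed_segment_ge2)

lemma open_to_complex_vimage: "open S \<Longrightarrow> open (to_complex -` S)"
  using continuous_open_vimage[of S to_complex] continuous_to_complex[of UNIV]
  by (simp add: continuous_on_eq_continuous_at)

text \<open>The vector-valued change of variables is applied to \<open>f\<close> times the unit
  vector of \<open>real^1\<close>, and the scalar factor is then compared.\<close>

lemma integral_linear_image_real:
  fixes f :: "real^'m::{finite,wellorder} \<Rightarrow> real" and g :: "real^'m::_ \<Rightarrow> real^'m::_"
  assumes g: "linear g" and f: "f absolutely_integrable_on (g ` S)" "(f \<circ> g) integrable_on S"
  shows "integral (g ` S) f = \<bar>det (matrix g)\<bar> * integral S (f \<circ> g)"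
proof -
  define F where "F x = f x *\<^sub>R (1 :: real^1)" for x
  have F: "F absolutely_integrable_on (g ` S)"
    unfolding F_def using f(1) by (rule absolutely_integrable_scaleR_right)
  have "integral (g ` S) F = \<bar>det (matrix g)\<bar> *\<^sub>R integral S (F \<circ> g)"
    by (rule integral_change_of_variables_linear[OF g disjI1[OF F]])
  moreover have "integral (g ` S) F = integral (g ` S) f *\<^sub>R 1"
    unfolding F_def using f(1)
    by (intro integral_unique has_integral_scaleR_left) (auto simp: absolutely_integrable_on_def)
  moreover have "integral S (F \<circ> g) = integral S (f \<circ> g) *\<^sub>R 1"
    unfolding F_def o_def using f(2)[unfolded o_def]
    by (intro integral_unique has_integral_scaleR_left) auto
  ultimately have "integral (g ` S) f *\<^sub>R (1 :: real^1) = (\<bar>det (matrix g)\<bar> * integral S (f \<circ> g)) *\<^sub>R 1"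
    by simp
  then show ?thesis by (simp add: vec_eq_iff)
qed

text \<open>Off the segment, a null set, the visual angle is continuous and bounded by
  \<open>pi\<close>.\<close>

lemma visual_angle_integrable:
  "(\<lambda>x. visual_angle a b (to_complex x)) absolutely_integrable_on ball 0 R"
proof -
  let ?s = "closed_segment (of_complex a) (of_complex b)"
  let ?T = "ball (0 :: real^2) R - ?s"
  have op: "open ?T" by (intro open_Diff) auto
  have "continuous_on ?T (\<lambda>x. visual_angle a b (to_complex x))"
  proof (rule continuous_on_compose2[OF _ continuous_to_complex])
    show "continuous_on (- closed_segment a b) (visual_angle a b)"
      by (auto intro!: continuous_at_imp_continuous_on isCont_visual_angle)
  qed (auto simp: to_complex_in_segment)
  then have meas: "(\<lambda>x. visual_angle a b (to_complex x)) \<in> borel_measurable (lebesgue_on ?T)"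
    using op by (intro continuous_imp_measurable_on_sets_lebesgue) auto
  have "?T \<in> lmeasurable"
    using op by (intro bounded_set_imp_lmeasurable) auto
  then have "(\<lambda>x. pi) integrable_on ?T" by (rule integrable_on_const)
  then have "(\<lambda>x. visual_angle a b (to_complex x)) absolutely_integrable_on ?T"
    using op meas less_imp_le[OF abs_visual_angle_less_pi[of "to_complex x" a b for x]]
    by (intro measurable_bounded_by_integrable_imp_absolutely_integrable)
      (auto simp: to_complex_in_segment)
  then show ?thesis
    by (rule absolutely_integrable_spike_set)
      (auto intro: negligible_subset[OF negligible_closed_segment[of "of_complex a" "of_complex b"]])
qed

section \<open>Integrals of visual angles over a disc\<close>

definition angle_integral :: "real \<Rightarrow> complex \<Rightarrow> complex \<Rightarrow> real" where
  "angle_integral R a b = integral (ball 0 R) (\<lambda>x. visual_angle a b (to_complex x))"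

lemma has_integral_visual_angle:
  "((\<lambda>x. visual_angle a b (to_complex x)) has_integral angle_integral R a b) (ball 0 R)"
  unfolding angle_integral_def
  using visual_angle_integrable[of R a b] by (auto simp: absolutely_integrable_on_def)

lemma angle_integral_swap: "angle_integral R b a = - angle_integral R a b"
proof -
  have "((\<lambda>x. visual_angle b a (to_complex x)) has_integral - angle_integral R a b) (ball 0 R)"
    by (rule has_integral_spike[OF negligible_closed_segment[of "of_complex a" "of_complex b"] _
          has_integral_neg[OF has_integral_visual_angle]])
      (simp add: visual_angle_swap to_complex_in_segment)
  then show ?thesis using has_integral_visual_angle has_integral_unique by blast
qed

text \<open>The reflection in the line through \<open>0\<close>, \<open>a\<close> and \<open>b\<close> preserves the disc and negates the visual angle.\<close>

lemma angle_integral_collinear: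
  assumes "Im (cnj a * b) = 0"
  shows "angle_integral R a b = 0"
proof -
  \<comment> \<open>For a unit \<open>s\<close>, the map sending \<open>z\<close> to
    \<open>s\<^sup>2 * cnj z\<close> is the reflection in the line through 0 and \<open>s\<close>.
    The two equations say that it fixes \<open>a\<close> and \<open>b\<close>; if both are 0, any
    line will do.\<close>
  obtain s where s: "norm s = 1" "a = s\<^sup>2 * cnj a" "b = s\<^sup>2 * cnj b"
  proof (cases "a = 0")
    case True
    then show ?thesis
    proof (cases "b = 0")
      case True
      then show ?thesis using \<open>a = 0\<close> by (intro that[of 1]) auto
    next
      case False
      have "b = (sgn b)\<^sup>2 * cnj b"
        using False complex_norm_square[of b]
        by (simp add: sgn_div_norm scaleR_conv_of_real power2_eq_square field_simps)
      then show ?thesis using \<open>a = 0\<close> False by (intro that[of "sgn b"]) (auto simp: norm_sgn)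
    qed
  next
    case False
    have "cnj (cnj a * b) = cnj a * b" using assms by (simp add: complex_eq_iff)
    then have ab: "a * cnj b = cnj a * b" by simp
    have n: "of_real (norm a) * of_real (norm a) = a * cnj a"
      using complex_norm_square[of a] by (simp add: power2_eq_square)
    have "(sgn a)\<^sup>2 = a * a / (a * cnj a)"
      using n False by (simp add: sgn_div_norm scaleR_conv_of_real power2_eq_square field_simps)
    then have sa: "(sgn a)\<^sup>2 = a / cnj a" using False by simp
    show ?thesis
      using False ab by (intro that[of "sgn a"]) (auto simp: norm_sgn sa field_simps)
  qed
  define g where "g x = of_complex (s\<^sup>2 * cnj (to_complex x))" for x
  have g: "linear g"
  proof (rule linearI)
    show "g (x + y) = g x + g y" for x y
      by (simp add: g_def linear_add[OF linear_to_complex] linear_add[OF linear_of_complex] distrib_left)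
    show "g (c *\<^sub>R x) = c *\<^sub>R g x" for c x
      by (simp add: g_def linear_scale[OF linear_to_complex] flip: linear_scale[OF linear_of_complex])
  qed
  have ng: "norm (g x) = norm x" for x
    by (simp add: g_def norm_mult norm_power s(1))
  have orth: "orthogonal_transformation g"
    using g ng by (simp add: orthogonal_transformation)
  have ss: "s * cnj s = 1" using s(1) complex_norm_square[of s] by simp
  have gg: "g (g x) = x" for x
  proof -
    have "s\<^sup>2 * cnj (s\<^sup>2 * cnj (to_complex x)) = (s * cnj s)\<^sup>2 * to_complex x"
      by (simp add: power2_eq_square mult_ac)
    then have "s\<^sup>2 * cnj (s\<^sup>2 * cnj (to_complex x)) = to_complex x" unfolding ss by simp
    then show ?thesis by (simp only: g_def to_of_complex of_to_complex)
  qed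
  have img: "g ` ball 0 R = ball 0 R"
  proof
    show "ball 0 R \<subseteq> g ` ball 0 R"
    proof
      fix x :: "real^2" assume "x \<in> ball 0 R"
      then have "g x \<in> ball 0 R" using ng by simp
      then show "x \<in> g ` ball 0 R" using gg[of x] by (metis image_eqI)
    qed
  qed (use ng in auto)
  let ?f = "\<lambda>x. visual_angle a b (to_complex x)"
  have neg: "?f (g x) = - ?f x" if "x \<notin> closed_segment (of_complex a) (of_complex b)" for x
  proof -
    let ?p = "to_complex x"
    have "(b - s\<^sup>2 * cnj ?p) / (a - s\<^sup>2 * cnj ?p) = (s\<^sup>2 * cnj (b - ?p)) / (s\<^sup>2 * cnj (a - ?p))"
      using s(2,3) by (simp add: right_diff_distrib)
    also have "\<dots> = cnj ((b - ?p) / (a - ?p))"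
      using s(1) by (cases "s = 0") auto
    finally have q: "(b - to_complex (g x)) / (a - to_complex (g x)) = cnj ((b - ?p) / (a - ?p))"
      by (simp only: g_def to_of_complex)
    have "?p \<notin> closed_segment a b" using that by (simp add: to_complex_in_segment)
    then show ?thesis
      unfolding visual_angle_def q using cnj_Ln[OF ratio_notin_nonpos, of ?p a b] by (metis cnj.simps(2))
  qed
  have hi: "((?f \<circ> g) has_integral - angle_integral R a b) (ball 0 R)"
    by (rule has_integral_spike[OF negligible_closed_segment[of "of_complex a" "of_complex b"] _
          has_integral_neg[OF has_integral_visual_angle]]) (use neg in auto)
  \<comment> \<open>The determinant of the orthogonal map \<open>g\<close> has absolute value 1, so
    the substitution shows the integral to be its own negative.\<close>
  have "integral (g ` ball 0 R) ?f = \<bar>det (matrix g)\<bar> * integral (ball 0 R) (?f \<circ> g)"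
    using hi visual_angle_integrable[of R a b] g
    by (intro integral_linear_image_real) (auto simp: img)
  then have "angle_integral R a b = - angle_integral R a b"
    using orthogonal_transformation_det[OF orth] integral_unique[OF hi]
    by (simp add: img angle_integral_def)
  then show ?thesis by simp
qed

lemma Im_Ln_neg_lt_imp: "Im z < 0 \<Longrightarrow> - pi < Im (Ln z) \<and> Im (Ln z) < 0"
  using Im_Ln_pos_le[of z] mpi_less_Im_Ln[of z] Im_Ln_le_pi[of z] by (cases "z = 0") auto

text \<open>The imaginary part of the ratio is the cross product of \<open>a - p\<close> and
  \<open>b - p\<close> divided by a positive square.\<close>

lemma visual_angle_sign:
  assumes "a \<noteq> p"
  shows "0 < Im (cnj (a - p) * (b - p)) \<Longrightarrow> 0 < visual_angle a b p \<and> visual_angle a b p < pi"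
    and "Im (cnj (a - p) * (b - p)) < 0 \<Longrightarrow> - pi < visual_angle a b p \<and> visual_angle a b p < 0"
proof -
  have eq: "Im ((b - p) / (a - p)) = Im (cnj (a - p) * (b - p)) / (norm (a - p))\<^sup>2"
    by (simp only: complex_div_cnj[of "b - p" "a - p"] mult.commute[of "b - p"]
        of_real_power[symmetric] Im_divide_of_real)
  have n: "(norm (a - p))\<^sup>2 > 0" using assms by simp
  show "0 < visual_angle a b p \<and> visual_angle a b p < pi" if "0 < Im (cnj (a - p) * (b - p))"
    unfolding visual_angle_def using that n by (intro Im_Ln_pos_lt_imp) (simp only: eq divide_pos_pos)
  show "- pi < visual_angle a b p \<and> visual_angle a b p < 0" if neg: "Im (cnj (a - p) * (b - p)) < 0"
  proof -
    have "Im ((b - p) / (a - p)) < 0" using that n by (simp only: eq divide_neg_pos)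
    then show ?thesis unfolding visual_angle_def by (rule Im_Ln_neg_lt_imp)
  qed
qed

text \<open>The three ratios have product 1, so their logarithms add up to a multiple of
  \<open>2 * pi * \<i>\<close>.\<close>

lemma triangle_angle_sum:
  fixes a b c p :: complex
  assumes "a \<noteq> p" "b \<noteq> p" "c \<noteq> p"
  obtains n :: int where "visual_angle a b p + visual_angle b c p + visual_angle c a p = 2 * of_int n * pi"
proof -
  let ?L = "Ln ((b - p) / (a - p)) + Ln ((c - p) / (b - p)) + Ln ((a - p) / (c - p))"
  have "exp ?L = 1" using assms by (simp add: exp_add)
  then obtain n :: int where "Im ?L = of_int (2 * n) * pi" by (auto simp: exp_eq_1)
  then show ?thesis using that[of n] by (simp add: visual_angle_def)
qed

lemma has_integral_indicator_superset:
  assumes "T \<in> lmeasurable" "T \<subseteq> S"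
  shows "(indicat_real T has_integral measure lebesgue T) S"
proof -
  have "(indicat_real T has_integral measure lebesgue T) UNIV"
    using assms(1) lmeasurable_iff_indicator_has_integral by blast
  moreover have "(\<lambda>x. if x \<in> S then indicat_real T x else 0) = indicat_real T"
    using assms(2) by (intro ext) (auto simp: indicator_def)
  ultimately show ?thesis
    by (subst has_integral_restrict_UNIV[symmetric]) simp
qed

text \<open>The reference triangle for linear images. Its measure is kept symbolic, since comparing
  signs takes only its positivity.\<close>

definition unit_triangle :: "(real^2) set" where
  "unit_triangle = {z. 0 < z $ 1 \<and> 0 < z $ 2 \<and> z $ 1 + z $ 2 < 1}"

lemma unit_triangle: "unit_triangle \<in> lmeasurable" "bounded unit_triangle" "0 < measure lebesgue unit_triangle"
proof -
  have op: "open unit_triangle"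
    unfolding unit_triangle_def by (intro open_Collect_conj open_Collect_less continuous_intros)
  show bd: "bounded unit_triangle"
  proof (rule boundedI)
    fix z assume "z \<in> unit_triangle"
    then show "norm z \<le> 2"
      using norm_le_l1_cart[of z] by (simp add: unit_triangle_def sum_2)
  qed
  show lm: "unit_triangle \<in> lmeasurable"
    using op bd by (intro bounded_set_imp_lmeasurable) auto
  have "vector [1/3, 1/3] \<in> unit_triangle" by (simp add: unit_triangle_def)
  then have "\<not> negligible unit_triangle" using op open_not_negligible by blast
  then show "0 < measure lebesgue unit_triangle"
    using lm by (simp add: negligible_iff_measure zero_less_measure_iff)
qed

text \<open>Closing up to the triangle \<open>0\<close>, \<open>a\<close>, \<open>b\<close> adds two segments on lines through \<open>0\<close>, which contribute nothing.\<close>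

lemma angle_integral_ccw:
  assumes pos: "0 < Im (cnj a * b)" and R: "norm a < R" "norm b < R"
  shows "angle_integral R a b = 2 * pi * measure lebesgue unit_triangle * Im (cnj a * b)"
proof -
  let ?D = "Im (cnj a * b)"
  \<comment> \<open>This linear map carries the reference triangle onto the open triangle with
    corners 0, \<open>a\<close>, \<open>b\<close>; its determinant is the cross product of
    \<open>a\<close> and \<open>b\<close>.\<close>
  define f where "f z = of_complex (z $ 1 *\<^sub>R a + z $ 2 *\<^sub>R b)" for z :: "real^2"
  have lf: "linear f"
  proof (rule linearI)
    show "f (x + y) = f x + f y" for x y
      by (simp add: f_def scaleR_add_left add_ac flip: linear_add[OF linear_of_complex])
    show "f (c *\<^sub>R x) = c *\<^sub>R f x" for c x
      by (simp add: f_def scaleR_add_right flip: linear_scale[OF linear_of_complex])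
  qed
  have detf: "det (matrix f) = ?D"
    by (simp add: det_2 matrix_def f_def of_complex_def axis_def)
  let ?T = "f ` unit_triangle"
  have mT: "?T \<in> lmeasurable" by (rule measurable_linear_image[OF lf unit_triangle(1)])
  have meas: "measure lebesgue ?T = ?D * measure lebesgue unit_triangle"
    using measure_lebesgue_linear_transformation[OF unit_triangle(2) _ lf] unit_triangle(1) pos
    by (simp add: detf fmeasurableD)
  have sub: "?T \<subseteq> ball 0 R"
  proof
    fix x assume "x \<in> ?T"
    then obtain z where z: "0 < z $ 1" "0 < z $ 2" "z $ 1 + z $ 2 < 1" "x = f z"
      by (auto simp: unit_triangle_def)
    have R0: "0 < R" using R(1) norm_ge_zero[of a] by linarith
    have "norm x \<le> z $ 1 * norm a + z $ 2 * norm b"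
      using z norm_triangle_ineq[of "z $ 1 *\<^sub>R a" "z $ 2 *\<^sub>R b"] by (simp add: f_def)
    also have "\<dots> \<le> z $ 1 * R + z $ 2 * R"
      using z R by (intro add_mono mult_left_mono) auto
    also have "\<dots> < R" using z(3) R0 by (simp flip: distrib_right)
    finally show "x \<in> ball 0 R" by simp
  qed
  \<comment> \<open>The line through \<open>c\<close> and \<open>d\<close>. Off the three side lines
    every orientation determinant is nonzero, so each visual angle has a definite sign.\<close>
  define N where "N c d = {x. Im (cnj (c - to_complex x) * (d - to_complex x)) = 0}" for c d
  have negN: "negligible (N c d)" if "c \<noteq> d" for c d
  proof -
    have "N c d = {x. vector [Im c - Im d, Re d - Re c] \<bullet> x = Re d * Im c - Re c * Im d}"
      by (auto simp: N_def to_complex_def inner_vec_def sum_2 algebra_simps)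
    moreover have "vector [Im c - Im d, Re d - Re c] \<noteq> (0 :: real^2)"
      using that by (auto simp: vec_eq_iff forall_2 complex_eq_iff)
    ultimately show ?thesis using negligible_hyperplane by auto
  qed
  have ab: "a \<noteq> b" "a \<noteq> 0" "b \<noteq> 0" using pos by auto
  then have neg: "negligible (N a b \<union> N b 0 \<union> N 0 a)"
    by (intro negligible_Un negN) auto
  let ?s = "\<lambda>x. visual_angle a b (to_complex x) + visual_angle b 0 (to_complex x) + visual_angle 0 a (to_complex x)"
  \<comment> \<open>The sum is a multiple of \<open>2 * pi\<close>. Inside the triangle all three
    angles lie strictly between 0 and \<open>pi\<close>, which leaves only \<open>2 * pi\<close>.
    Outside it the signs are mixed, because the determinants add up to \<open>?D > 0\<close> and
    cannot all be negative; the sum is then below \<open>2 * pi\<close> in absolute value, hence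
    0.\<close>
  have sumeq: "?s x = 2 * pi * indicat_real ?T x" if x: "x \<notin> N a b \<union> N b 0 \<union> N 0 a" for x
  proof -
    define p where "p = to_complex x"
    let ?A = "Im (cnj (a - p) * (b - p))" and ?B = "Im (cnj (b - p) * (0 - p))" and ?C = "Im (cnj (0 - p) * (a - p))"
    have nz: "?A \<noteq> 0" "?B \<noteq> 0" "?C \<noteq> 0" using x by (auto simp: N_def p_def)
    then have ne: "a \<noteq> p" "b \<noteq> p" "0 \<noteq> p" by auto
    have S: "?A + ?B + ?C = ?D" by (simp add: algebra_simps)
    obtain n :: int where n: "visual_angle a b p + visual_angle b 0 p + visual_angle 0 a p = 2 * of_int n * pi"
      using triangle_angle_sum[OF ne] .
    note sg = visual_angle_sign[OF ne(1), of b] visual_angle_sign[OF ne(2), of 0] visual_angle_sign[OF ne(3), of a]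
    have inT: "x \<in> ?T \<longleftrightarrow> 0 < ?A \<and> 0 < ?B \<and> 0 < ?C"
    proof
      assume "x \<in> ?T"
      then obtain z where z: "0 < z $ 1" "0 < z $ 2" "z $ 1 + z $ 2 < 1" "x = f z"
        by (auto simp: unit_triangle_def)
      then have p: "p = z $ 1 *\<^sub>R a + z $ 2 *\<^sub>R b" by (simp add: p_def f_def)
      have "?B = z $ 1 * ?D" "?C = z $ 2 * ?D" unfolding p by (simp_all add: algebra_simps)
      moreover from this have "?A = (1 - (z $ 1 + z $ 2)) * ?D" using S by (simp add: algebra_simps)
      ultimately show "0 < ?A \<and> 0 < ?B \<and> 0 < ?C" using z pos by simp
    next
      assume pp: "0 < ?A \<and> 0 < ?B \<and> 0 < ?C"
      define z :: "real^2" where "z = vector [?B / ?D, ?C / ?D]"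
      \<comment> \<open>Cramer's rule: the determinants divided by \<open>?D\<close> are barycentric
        coordinates of \<open>p\<close>.\<close>
      have "?D *\<^sub>R p = ?B *\<^sub>R a + ?C *\<^sub>R b"
        by (simp add: complex_eq_iff algebra_simps)
      then have "p = (1 / ?D) *\<^sub>R (?B *\<^sub>R a + ?C *\<^sub>R b)"
        using pos by (metis (no_types, lifting) divide_self_if less_irrefl scaleR_one scaleR_scaleR times_divide_eq_left mult_1)
      then have "p = z $ 1 *\<^sub>R a + z $ 2 *\<^sub>R b"
        by (simp add: z_def scaleR_add_right)
      then have "x = f z" unfolding f_def p_def by (metis of_to_complex)
      moreover have "?B / ?D + ?C / ?D < 1"
        using S pp pos by (simp add: divide_simps flip: add_divide_distrib)
      then have "z \<in> unit_triangle"
        using pp pos by (simp add: unit_triangle_def z_def)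
      ultimately show "x \<in> ?T" by blast
    qed
    have pi_mult_less: "of_int m * pi < of_int k * pi \<longleftrightarrow> m < k" for m k :: int
      by (simp add: mult_less_cancel_right_pos)
    have dich: "(0 < d \<and> 0 < t \<and> t < pi) \<or> (d < 0 \<and> - pi < t \<and> t < 0)"
      if "d \<noteq> 0" "0 < d \<Longrightarrow> 0 < t \<and> t < pi" "d < 0 \<Longrightarrow> - pi < t \<and> t < 0" for d t :: real
      using that by linarith
    note d3 = dich[OF nz(1) sg(1,2)] dich[OF nz(2) sg(3,4)] dich[OF nz(3) sg(5,6)]
    show ?thesis
    proof (cases "x \<in> ?T")
      case True
      then have "0 < ?A" "0 < ?B" "0 < ?C" using inT by blast+
      with d3 have "of_int 0 * pi < of_int n * pi" "of_int n * pi < of_int 2 * pi"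
        using n by linarith+
      then have "0 < n" "n < 2" unfolding pi_mult_less by auto
      then have "n = 1" by simp
      then show ?thesis using n True by (simp add: p_def)
    next
      case False
      then have "\<not> (0 < ?A \<and> 0 < ?B \<and> 0 < ?C)" using inT by blast
      moreover have "\<not> (?A < 0 \<and> ?B < 0 \<and> ?C < 0)" using S pos by linarith
      ultimately have "of_int n * pi < of_int 1 * pi" "of_int (-1) * pi < of_int n * pi"
        using d3 n by linarith+
      then have "n < 1" "-1 < n" unfolding pi_mult_less by auto
      then have "n = 0" by simp
      then show ?thesis using n False by (simp add: p_def)
    qed
  qed
  have "(indicat_real ?T has_integral measure lebesgue ?T) (ball 0 R)"
    using mT sub by (rule has_integral_indicator_superset)
  then have "((\<lambda>x. 2 * pi * indicat_real ?T x) has_integral 2 * pi * measure lebesgue ?T) (ball 0 R)"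
    by (rule has_integral_mult_right)
  then have "(?s has_integral 2 * pi * measure lebesgue ?T) (ball 0 R)"
    by (rule has_integral_spike[OF neg, rotated]) (use sumeq in auto)
  moreover have "(?s has_integral angle_integral R a b + angle_integral R b 0 + angle_integral R 0 a) (ball 0 R)"
    by (intro has_integral_add has_integral_visual_angle)
  ultimately have "angle_integral R a b + angle_integral R b 0 + angle_integral R 0 a = 2 * pi * measure lebesgue ?T"
    using has_integral_unique by blast
  then show ?thesis using meas by (simp add: angle_integral_collinear)
qed

lemma angle_integral_eq:
  assumes "norm a < R" "norm b < R"
  shows "angle_integral R a b = 2 * pi * measure lebesgue unit_triangle * Im (cnj a * b)"
proof -
  consider "Im (cnj a * b) = 0" | "0 < Im (cnj a * b)" | "0 < Im (cnj b * a)"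
    by (auto simp: algebra_simps) linarith
  then show ?thesis
  proof cases
    case 3
    have "Im (cnj a * b) = - Im (cnj b * a)" by simp
    then show ?thesis
      by (simp only: angle_integral_swap[of R a b] angle_integral_ccw[OF 3 assms(2,1)] mult_minus_right)
  qed (use assms angle_integral_collinear angle_integral_ccw in auto)
qed

text \<open>Up to the null boundary the angle sum is \<open>C\<close> inside and 0 outside, so its
  integral over a large disc is \<open>C\<close> times the enclosed area. Integrating edge by edge
  gives a positive multiple of the shoelace sum.\<close>

lemma poly_angle_sign:
  assumes vs: "simple_polygon vs"
    and C: "\<And>p. p \<in> inside (poly_boundary vs) \<Longrightarrow> poly_angle vs p = C"
  shows "0 < C \<longleftrightarrow> 0 < signed_area2 vs"
proof -
  let ?I = "to_complex -` inside (poly_boundary vs)"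
  have "bounded (poly_boundary vs \<union> inside (poly_boundary vs))"
    using poly_Jordan(3)[OF vs] compact_imp_bounded[OF compact_poly_boundary] by simp
  then obtain R where R: "\<And>p. p \<in> poly_boundary vs \<union> inside (poly_boundary vs) \<Longrightarrow> norm p < R"
    unfolding bounded_pos_less by blast
  have pvR: "norm (pv vs i) < R" if "i < length vs" for i
    using R[of "pv vs i"] pedge_subset_boundary[OF that] by (auto simp: pedge_def)
  have pvR': "norm (pv vs (Suc i)) < R" if "i < length vs" for i
    using R[of "pv vs (Suc i)"] pedge_subset_boundary[OF that] by (auto simp: pedge_def)
  have "((\<lambda>x. poly_angle vs (to_complex x)) has_integral
      (\<Sum>i<length vs. angle_integral R (pv vs i) (pv vs (Suc i)))) (ball 0 R)"
    unfolding poly_angle_def by (intro has_integral_sum has_integral_visual_angle) auto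
  moreover have "(\<Sum>i<length vs. angle_integral R (pv vs i) (pv vs (Suc i))) =
      2 * pi * measure lebesgue unit_triangle * signed_area2 vs"
    unfolding signed_area2_def sum_distrib_left
    using pvR pvR' by (intro sum.cong angle_integral_eq) auto
  ultimately have 1: "((\<lambda>x. poly_angle vs (to_complex x)) has_integral
      2 * pi * measure lebesgue unit_triangle * signed_area2 vs) (ball 0 R)" by simp
  have op: "open ?I" using poly_Jordan(4)[OF vs] by (rule open_to_complex_vimage)
  have sub: "?I \<subseteq> ball 0 R" using R by (auto simp flip: norm_to_complex)
  have lm: "?I \<in> lmeasurable"
    using op bounded_subset[OF bounded_ball sub] by (intro bounded_set_imp_lmeasurable) auto
  obtain q where "q \<in> inside (poly_boundary vs)" using poly_Jordan(1)[OF vs] by blast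
  then have "of_complex q \<in> ?I" by simp
  then have "\<not> negligible ?I" using op open_not_negligible by blast
  then have pos: "0 < measure lebesgue ?I"
    using lm by (simp add: negligible_iff_measure zero_less_measure_iff)
  let ?N = "\<Union>i<length vs. closed_segment (of_complex (pv vs i)) (of_complex (pv vs (Suc i)))"
  have neg: "negligible ?N"
    by (intro negligible_Union) (auto simp: negligible_closed_segment)
  have N: "x \<in> ?N \<longleftrightarrow> to_complex x \<in> poly_boundary vs" for x
    by (simp add: poly_boundary_def pedge_def to_complex_in_segment)
  have eq: "poly_angle vs (to_complex x) = C * indicat_real ?I x" if "x \<notin> ?N" for x
  proof (cases "x \<in> ?I")
    case True
    then show ?thesis using C by simp
  next
    case False
    then have "to_complex x \<in> outside (poly_boundary vs)"
      using that N[of x] inside_Un_outside[of "poly_boundary vs"] by blast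
    then show ?thesis using False poly_angle_outside[OF vs] by simp
  qed
  have "(indicat_real ?I has_integral measure lebesgue ?I) (ball 0 R)"
    using lm sub by (rule has_integral_indicator_superset)
  then have "((\<lambda>x. C * indicat_real ?I x) has_integral C * measure lebesgue ?I) (ball 0 R)"
    by (rule has_integral_mult_right)
  then have "((\<lambda>x. poly_angle vs (to_complex x)) has_integral C * measure lebesgue ?I) (ball 0 R)"
    by (rule has_integral_spike[OF neg, rotated]) (use eq in auto)
  then have "C * measure lebesgue ?I = 2 * pi * measure lebesgue unit_triangle * signed_area2 vs"
    using 1 has_integral_unique by blast
  moreover have "0 < 2 * pi * measure lebesgue unit_triangle" using unit_triangle(3) by simp
  ultimately show ?thesis using pos
    by (metis zero_less_mult_pos zero_less_mult_pos2 mult_pos_pos)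
qed

section \<open>Interior sectors for either orientation\<close>

text \<open>The two edge directions are ordered by orientation, so that the interior sector is
  always swept counterclockwise from \<open>corner_first\<close> to
  \<open>corner_last\<close>.\<close>

definition corner_first :: "complex list \<Rightarrow> nat \<Rightarrow> complex" where
  "corner_first vs i = (if signed_area2 vs > 0 then pv vs (Suc i) else pv vs (i + length vs - 1)) - pv vs i"

definition corner_last :: "complex list \<Rightarrow> nat \<Rightarrow> complex" where
  "corner_last vs i = (if signed_area2 vs > 0 then pv vs (i + length vs - 1) else pv vs (Suc i)) - pv vs i"

lemma interior_angle_eq: "interior_angle vs i = Arg2pi (corner_last vs i / corner_first vs i)"
  by (simp add: interior_angle_def ccw_angle_def corner_first_def corner_last_def Let_def)

text \<open>The sign of the shoelace sum selects the case of \<open>corner_dichotomy\<close>. For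
  nonpositive sign, angles are measured from \<open>w\<close> instead of \<open>u\<close>: the
  interior angle becomes \<open>2 * pi - \<alpha>\<close>, and the two sectors seen from
  \<open>u\<close> change roles.\<close>

lemma corner_sector:
  assumes vs: "simple_polygon vs" and i: "i < length vs"
  shows "corner_first vs i \<noteq> 0" "corner_last vs i \<noteq> 0" "0 < interior_angle vs i"
    and "\<And>n. n \<noteq> 0 \<Longrightarrow> 0 < Arg2pi (n / corner_first vs i) \<Longrightarrow>
      Arg2pi (n / corner_first vs i) < interior_angle vs i \<Longrightarrow>
      \<forall>\<^sub>F t in at_right 0. pv vs i + of_real t * n \<in> inside (poly_boundary vs)"
    and "\<And>n. n \<noteq> 0 \<Longrightarrow> interior_angle vs i < Arg2pi (n / corner_first vs i) \<Longrightarrow>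
      \<forall>\<^sub>F t in at_right 0. pv vs i + of_real t * n \<in> outside (poly_boundary vs)"
proof -
  define v where "v = pv vs i"
  define u where "u = pv vs (Suc i) - v"
  define w where "w = pv vs (i + length vs - 1) - v"
  define \<alpha> where "\<alpha> = Arg2pi (w / u)"
  note ctx = vs i v_def u_def w_def refl
  obtain C where C: "\<And>p. p \<in> inside (poly_boundary vs) \<Longrightarrow> poly_angle vs p = C"
    using poly_angle_inside[OF vs] by blast
  note sgn = poly_angle_sign[OF vs C]
  note dich = corner_dichotomy[OF ctx C, folded \<alpha>_def]
  note nz = corner_nonzero[OF ctx]
  have \<alpha>: "0 < \<alpha>" "\<alpha> < 2 * pi" using corner_angle_pos[OF ctx] Arg2pi_lt_2pi by (auto simp: \<alpha>_def)
  show "corner_first vs i \<noteq> 0" "corner_last vs i \<noteq> 0"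
    using nz by (auto simp: corner_first_def corner_last_def u_def w_def v_def)
  have inv: "Arg2pi (u / w) = 2 * pi - \<alpha>"
    using Arg2pi_inverse_pos[of "w / u"] \<alpha> by (simp add: \<alpha>_def)
  have quot: "Arg2pi (n / w) = (if \<alpha> \<le> Arg2pi (n / u) then Arg2pi (n / u) - \<alpha> else Arg2pi (n / u) - \<alpha> + 2 * pi)"
    if "n \<noteq> 0" for n
    using Arg2pi_quotient[of "n / u" "w / u"] nz that by (simp add: \<alpha>_def)
  show "0 < interior_angle vs i"
    using \<alpha> inv by (simp add: interior_angle_eq corner_first_def corner_last_def \<alpha>_def u_def w_def v_def)
  show "\<forall>\<^sub>F t in at_right 0. pv vs i + of_real t * n \<in> inside (poly_boundary vs)"
    if n: "n \<noteq> 0" "0 < Arg2pi (n / corner_first vs i)" "Arg2pi (n / corner_first vs i) < interior_angle vs i" for n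
  proof (cases "signed_area2 vs > 0")
    case True
    then have "corner_first vs i = u" "interior_angle vs i = \<alpha>"
      by (auto simp: interior_angle_eq corner_first_def corner_last_def \<alpha>_def u_def w_def v_def)
    then show ?thesis using dich sgn True n pi_gt_zero unfolding v_def[symmetric] by auto
  next
    case False
    then have "corner_first vs i = w" "interior_angle vs i = Arg2pi (u / w)"
      by (auto simp: interior_angle_eq corner_first_def corner_last_def u_def w_def v_def)
    then have "\<alpha> < Arg2pi (n / u)"
      using n inv quot[OF n(1)] Arg2pi_ge_0[of "n / u"] by (auto split: if_splits)
    then show ?thesis using dich sgn False n pi_gt_zero unfolding v_def[symmetric] by auto
  qed
  show "\<forall>\<^sub>F t in at_right 0. pv vs i + of_real t * n \<in> outside (poly_boundary vs)"
    if n: "n \<noteq> 0" "interior_angle vs i < Arg2pi (n / corner_first vs i)" for n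
  proof (cases "signed_area2 vs > 0")
    case True
    then have "corner_first vs i = u" "interior_angle vs i = \<alpha>"
      by (auto simp: interior_angle_eq corner_first_def corner_last_def \<alpha>_def u_def w_def v_def)
    then show ?thesis using dich sgn True n pi_gt_zero unfolding v_def[symmetric] by auto
  next
    case False
    then have "corner_first vs i = w" "interior_angle vs i = Arg2pi (u / w)"
      by (auto simp: interior_angle_eq corner_first_def corner_last_def u_def w_def v_def)
    then have "0 < Arg2pi (n / u)" "Arg2pi (n / u) < \<alpha>"
      using n inv quot[OF n(1)] Arg2pi_lt_2pi[of "n / u"] by (auto split: if_splits)
    then show ?thesis using dich sgn False n pi_gt_zero unfolding v_def[symmetric] by auto
  qed
qed

lemma corner_edges:
  assumes vs: "simple_polygon vs" and i: "i < length vs"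
  obtains j k where "j < length vs" "k < length vs"
    "closed_segment (pv vs i) (pv vs i + corner_first vs i) = pedge vs j"
    "closed_segment (pv vs i) (pv vs i + corner_last vs i) = pedge vs k"
proof -
  note ctx = vs i refl refl refl refl
  let ?k = "(i + length vs - 1) mod length vs"
  have 1: "closed_segment (pv vs i) (pv vs (Suc i)) = pedge vs i" by (simp add: pedge_def)
  have 2: "closed_segment (pv vs i) (pv vs (i + length vs - 1)) = pedge vs ?k"
    unfolding pedge_def prev_edge(3,4)[OF ctx] by (simp add: closed_segment_commute)
  show ?thesis
  proof (cases "signed_area2 vs > 0")
    case True
    then show ?thesis
      using 1 2 i prev_edge(1)[OF ctx] by (intro that[of i ?k]) (simp_all add: corner_first_def corner_last_def)
  next
    case False
    then show ?thesis
      using 1 2 i prev_edge(1)[OF ctx] by (intro that[of ?k i]) (simp_all add: corner_first_def corner_last_def)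
  qed
qed

lemma vertex_in_pedge_endpoint:
  assumes vs: "simple_polygon vs" and "x \<in> set vs" "j < length vs" "x \<in> pedge vs j"
  shows "x \<in> {pv vs j, pv vs (Suc j)}"
proof -
  obtain i where i: "i < length vs" "x = pv vs i"
    using assms(2) by (metis in_set_conv_nth pv_eq_nth)
  then have "j = i \<or> j = (i + length vs - 1) mod length vs"
    using vertex_in_pedge[OF vs i(1) assms(3)] assms(4) by simp
  then show ?thesis
    using prev_edge(4)[OF vs i(1) refl refl refl refl] i(2) by auto
qed

lemma pv_in_set: "vs \<noteq> [] \<Longrightarrow> pv vs i \<in> set vs"
  by (simp add: pv_def)

lemma pedge_Int_endpoint:
  assumes vs: "simple_polygon vs" and ij: "i < length vs" "j < length vs" "i \<noteq> j"
    and x: "x \<in> pedge vs i" "x \<in> pedge vs j"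
  shows "x \<in> {pv vs i, pv vs (Suc i)}"
proof -
  have "x = pv vs i \<or> x = pv vs j" using pedge_Int[OF vs ij] x by blast
  moreover have "vs \<noteq> []" using ij by auto
  ultimately show ?thesis using vertex_in_pedge_endpoint[OF vs _ ij(1) x(1)] pv_in_set by auto
qed

lemma vertex_in_boundary: "x \<in> set vs \<Longrightarrow> x \<in> poly_boundary vs"
  by (auto simp: poly_boundary_def pedge_def in_set_conv_nth intro!: bexI) (metis ends_in_segment(1) pv_eq_nth lessThan_iff)

text \<open>For one small \<open>t\<close> the points \<open>v\<close>, \<open>v + t n\<close> and
  \<open>v + t m\<close> lie on a common line, so both directions are real multiples of
  \<open>y - x\<close>. This will rule out that distinct quadrilaterals share a sector.\<close>

lemma directions_in_segment:
  assumes "S \<subseteq> closed_segment x y" "v \<in> S" "n \<noteq> 0"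
    and "\<forall>\<^sub>F t in at_right 0. v + of_real t * n \<in> S" "\<forall>\<^sub>F t in at_right 0. v + of_real t * m \<in> S"
  shows "Im (m / n) = 0"
proof -
  have "\<forall>\<^sub>F t in at_right (0::real). 0 < t \<and> v + of_real t * n \<in> S \<and> v + of_real t * m \<in> S"
    using assms(4,5) eventually_at_right_less[of "0::real"] by eventually_elim auto
  then obtain t :: real where t: "0 < t" "v + of_real t * n \<in> S" "v + of_real t * m \<in> S"
    using eventually_happens'[OF trivial_limit_at_right_real] by blast
  have seg: "\<exists>r. p = x + of_real r * (y - x)" if p: "p \<in> S" for p
  proof -
    obtain r where "p = (1 - r) *\<^sub>R x + r *\<^sub>R y" using assms(1) p unfolding in_segment subset_iff by blast
    then show ?thesis by (intro exI[of _ r]) (simp add: scaleR_conv_of_real algebra_simps)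
  qed
  obtain r0 r1 r2 where r: "v = x + of_real r0 * (y - x)" "v + of_real t * n = x + of_real r1 * (y - x)"
    "v + of_real t * m = x + of_real r2 * (y - x)"
    using seg[OF assms(2)] seg[OF t(2)] seg[OF t(3)] by blast
  have n: "of_real t * n = of_real (r1 - r0) * (y - x)" 
  proof -
    have "of_real t * n = (v + of_real t * n) - v" by simp
    also have "\<dots> = of_real (r1 - r0) * (y - x)" unfolding r(2) unfolding r(1) by (simp add: algebra_simps)
    finally show ?thesis .
  qed
  have m: "of_real t * m = of_real (r2 - r0) * (y - x)" 
  proof -
    have "of_real t * m = (v + of_real t * m) - v" by simp
    also have "\<dots> = of_real (r2 - r0) * (y - x)" unfolding r(3) unfolding r(1) by (simp add: algebra_simps)
    finally show ?thesis .
  qed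
  have "y - x \<noteq> 0" using n t(1) assms(3) by auto
  moreover have "m / n = (of_real t * m) / (of_real t * n)" using t(1) by simp
  ultimately have "m / n = of_real ((r2 - r0) / (r1 - r0))" unfolding n m by simp
  then show ?thesis by (simp only: Im_complex_of_real)
qed

section \<open>Euler's inequality for meshes\<close>

text \<open>Gaussian elimination, by induction on the equations. If equation \<open>y\<close> has a
  pivot \<open>w\<close>, then \<open>B\<close> is the system with unknown \<open>w\<close>
  eliminated, and \<open>z'\<close> restores that unknown by back substitution.\<close>

lemma ex_nonzero_solution:
  fixes A :: "'y \<Rightarrow> 'x \<Rightarrow> real"
  assumes "finite X" "finite Y" "card Y < card X"
  shows "\<exists>z. (\<exists>x\<in>X. z x \<noteq> 0) \<and> (\<forall>y\<in>Y. (\<Sum>x\<in>X. A y x * z x) = 0)"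
  using assms(2,1,3)
proof (induction Y arbitrary: X A rule: finite_induct)
  case empty
  then obtain x where "x \<in> X" by (metis card.empty ex_in_conv less_irrefl)
  then show ?case by (intro exI[of _ "\<lambda>_. 1"]) auto
next
  case (insert y Y)
  show ?case
  proof (cases "\<exists>x\<in>X. A y x \<noteq> 0")
    case False
    then show ?thesis using insert.IH[of X A] insert.prems insert.hyps by auto
  next
    case True
    then obtain w where w: "w \<in> X" "A y w \<noteq> 0" by blast
    let ?X = "X - {w}"
    define B where "B y' x = A y' x - A y' w * A y x / A y w" for y' x
    have "card Y < card ?X" using insert.prems insert.hyps w by simp
    then obtain z where z: "\<exists>x\<in>?X. z x \<noteq> 0" "\<And>y'. y' \<in> Y \<Longrightarrow> (\<Sum>x\<in>?X. B y' x * z x) = 0"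
      using insert.IH[of ?X B] insert.prems by auto
    define z' where "z' x = (if x = w then - (\<Sum>x\<in>?X. A y x * z x) / A y w else z x)" for x
    have sum: "(\<Sum>x\<in>X. A y' x * z' x) = A y' w * z' w + (\<Sum>x\<in>?X. A y' x * z x)" for y'
      using w insert.prems by (subst sum.remove[of _ w]) (auto simp: z'_def intro!: sum.cong)
    have "(\<Sum>x\<in>X. A y x * z' x) = 0"
      unfolding sum using w by (simp add: z'_def)
    moreover have "(\<Sum>x\<in>X. A y' x * z' x) = 0" if "y' \<in> Y" for y'
    proof -
      have "(\<Sum>x\<in>?X. B y' x * z x) = (\<Sum>x\<in>?X. A y' x * z x - A y' w / A y w * (A y x * z x))"
        by (intro sum.cong) (auto simp: B_def field_simps)
      also have "\<dots> = (\<Sum>x\<in>?X. A y' x * z x) + A y' w * z' w"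
        unfolding sum_subtractf sum_distrib_left[symmetric] by (simp add: z'_def)
      finally show ?thesis unfolding sum using z(2)[OF that] by simp
    qed
    moreover have "\<exists>x\<in>X. z' x \<noteq> 0" using z(1) by (auto simp: z'_def)
    ultimately show ?thesis by (intro exI[of _ z']) auto
  qed
qed

section \<open>The jump of an angle sum across an edge\<close>

text \<open>On the perpendicular bisector the ratio is \<open>- y t\<close>, where
  \<open>y t\<close> tends to 1 and the sign of its imaginary part depends on the side. Negating the
  argument of \<open>Ln\<close> therefore adds \<open>pi\<close> on one side and subtracts it on the
  other.\<close>

lemma visual_angle_limit_midpoint:
  assumes "a \<noteq> b"
  defines "m \<equiv> (a + b) / 2" and "h \<equiv> (b - a) / 2"
  shows "((\<lambda>t. visual_angle a b (m + of_real t * (\<i> * h))) \<longlongrightarrow> pi) (at_right 0)"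
    and "((\<lambda>t. visual_angle a b (m + of_real t * (- \<i> * h))) \<longlongrightarrow> - pi) (at_right 0)"
proof -
  have h: "h \<noteq> 0" using assms by simp
  have ab: "a = m - h" "b = m + h" by (simp_all add: m_def h_def field_simps)
  define y where "y t = (1 - \<i> * of_real t) / (1 + \<i> * of_real t)" for t :: real
  have den: "1 + \<i> * of_real t \<noteq> 0" for t :: real
    by (auto simp: complex_eq_iff)
  have den': "1 - \<i> * of_real t \<noteq> 0" for t :: real
    by (auto simp: complex_eq_iff)
  have y0: "y t \<noteq> 0" for t using den den' by (simp add: y_def)
  have Imy: "Im (y t) = - 2 * t / (1 + t\<^sup>2)" for t
    by (simp add: y_def Im_divide power2_eq_square)
  have q1: "(b - (m + of_real t * (\<i> * h))) / (a - (m + of_real t * (\<i> * h))) = - y t" for t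
  proof -
    have "(b - (m + of_real t * (\<i> * h))) / (a - (m + of_real t * (\<i> * h))) =
        (h * (1 - \<i> * of_real t)) / (- (h * (1 + \<i> * of_real t)))"
      by (simp add: ab algebra_simps)
    also have "\<dots> = - y t" using h by (simp add: y_def)
    finally show ?thesis .
  qed
  have q2: "(b - (m + of_real t * (- \<i> * h))) / (a - (m + of_real t * (- \<i> * h))) = - y (- t)" for t
    using q1[of "- t"] by simp
  have lim: "((\<lambda>t. Im (Ln (y (c * t)))) \<longlongrightarrow> 0) (at_right 0)" for c
  proof -
    have "((\<lambda>t. Im (Ln (y (c * t)))) \<longlongrightarrow> Im (Ln (y (c * 0)))) (at_right 0)"
      unfolding y_def by (intro tendsto_intros) auto
    then show ?thesis by (simp add: y_def)
  qed
  have "\<forall>\<^sub>F t in at_right 0. Im (Ln (y (1 * t))) + pi = visual_angle a b (m + of_real t * (\<i> * h))"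
    using eventually_at_right_less[of "0::real"]
  proof eventually_elim
    case (elim t)
    then have "Im (y t) < 0" by (simp add: Imy divide_neg_pos add_pos_nonneg)
    then show ?case unfolding visual_angle_def q1 by (simp add: Ln_minus[OF y0])
  qed
  moreover have "((\<lambda>t. Im (Ln (y (1 * t))) + pi) \<longlongrightarrow> 0 + pi) (at_right 0)"
    by (intro tendsto_add lim tendsto_const)
  ultimately show "((\<lambda>t. visual_angle a b (m + of_real t * (\<i> * h))) \<longlongrightarrow> pi) (at_right 0)"
    using Lim_transform_eventually by fastforce
  have "\<forall>\<^sub>F t in at_right 0. Im (Ln (y (- 1 * t))) - pi = visual_angle a b (m + of_real t * (- \<i> * h))"
    using eventually_at_right_less[of "0::real"]
  proof eventually_elim
    case (elim t)
    then have "Im (y (- t)) > 0" by (simp add: Imy add_pos_nonneg)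
    then show ?case unfolding visual_angle_def q2 by (simp add: Ln_minus[OF y0])
  qed
  moreover have "((\<lambda>t. Im (Ln (y (- 1 * t))) - pi) \<longlongrightarrow> 0 - pi) (at_right 0)"
    by (intro tendsto_diff lim tendsto_const)
  ultimately show "((\<lambda>t. visual_angle a b (m + of_real t * (- \<i> * h))) \<longlongrightarrow> - pi) (at_right 0)"
    using Lim_transform_eventually by fastforce
qed

lemma normal_not_in_segment:
  assumes "a \<noteq> b" "t \<noteq> 0"
  shows "(a + b) / 2 + of_real t * (\<i> * ((b - a) / 2)) \<notin> closed_segment a b"
proof
  assume "(a + b) / 2 + of_real t * (\<i> * ((b - a) / 2)) \<in> closed_segment a b"
  then obtain s where "(a + b) / 2 + of_real t * (\<i> * ((b - a) / 2)) = (1 - s) *\<^sub>R a + s *\<^sub>R b"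
    by (auto simp: in_segment)
  moreover have "(\<i> * of_real t - of_real (2 * s - 1)) * (b - a) =
      2 * ((a + b) / 2 + of_real t * (\<i> * ((b - a) / 2)) - ((1 - s) *\<^sub>R a + s *\<^sub>R b))"
    by (simp add: scaleR_conv_of_real field_simps)
  ultimately have "(\<i> * of_real t - of_real (2 * s - 1)) * (b - a) = 0"
    by simp
  then have "\<i> * of_real t = of_real (2 * s - 1)" using assms by simp
  then have "Im (\<i> * of_real t) = Im (of_real (2 * s - 1))" by simp
  then show False using assms by simp
qed

text \<open>Approach the midpoint of edge \<open>x\<close> from both sides. The remaining edges
  contribute the same limit \<open>L\<close> each time, so \<open>L + z x * pi\<close> and
  \<open>L - z x * pi\<close> both vanish.\<close>

lemma cycle_weight_zero:
  assumes fin: "finite X" and x: "x \<in> X" "a x \<noteq> b x"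
    and off: "\<And>x'. x' \<in> X \<Longrightarrow> x' \<noteq> x \<Longrightarrow> (a x + b x) / 2 \<notin> closed_segment (a x') (b x')"
    and zero: "\<And>p. (\<And>x. x \<in> X \<Longrightarrow> p \<notin> closed_segment (a x) (b x)) \<Longrightarrow>
      (\<Sum>x\<in>X. z x * visual_angle (a x) (b x) p) = 0"
  shows "z x = 0"
proof -
  define m where "m = (a x + b x) / 2"
  define h where "h = (b x - a x) / 2"
  define L where "L = (\<Sum>x'\<in>X - {x}. z x' * visual_angle (a x') (b x') m)"
  have *: "L + z x * l = 0"
    if n: "n = \<i> * h \<or> n = - \<i> * h"
      and l: "((\<lambda>t. visual_angle (a x) (b x) (m + of_real t * n)) \<longlongrightarrow> l) (at_right 0)" for n l
  proof -
    have tt: "((\<lambda>t::real. m + of_real t * n) \<longlongrightarrow> m) (at_right 0)"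
      by (rule tendsto_eq_intros refl | simp)+
    have "((\<lambda>t. (\<Sum>x'\<in>X - {x}. z x' * visual_angle (a x') (b x') (m + of_real t * n)) +
        z x * visual_angle (a x) (b x) (m + of_real t * n)) \<longlongrightarrow> L + z x * l) (at_right 0)"
      unfolding L_def
    proof (intro tendsto_add tendsto_sum tendsto_mult tendsto_const l)
      fix x' assume "x' \<in> X - {x}"
      then show "((\<lambda>t. visual_angle (a x') (b x') (m + of_real t * n)) \<longlongrightarrow> visual_angle (a x') (b x') m) (at_right 0)"
        using isCont_tendsto_compose[OF isCont_visual_angle tt] off[of x'] by (simp add: m_def)
    qed
    moreover have "\<forall>\<^sub>F t in at_right 0. \<forall>x'\<in>X. m + of_real t * n \<notin> closed_segment (a x') (b x')"
    proof (rule eventually_ball_finite[OF fin], rule ballI)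
      fix x' assume x': "x' \<in> X"
      show "\<forall>\<^sub>F t in at_right 0. m + of_real t * n \<notin> closed_segment (a x') (b x')"
      proof (cases "x' = x")
        case True
        show ?thesis
          using eventually_at_right_less[of "0::real"]
        proof eventually_elim
          case (elim t)
          then show ?case
            using True n normal_not_in_segment[OF x(2), of t, folded m_def h_def]
              normal_not_in_segment[OF x(2), of "- t", folded m_def h_def]
            by auto
        qed
      next
        case False
        then have "m \<in> - closed_segment (a x') (b x')" using off[OF x'] by (simp add: m_def)
        then show ?thesis
          using topological_tendstoD[OF tt open_Compl[OF closed_segment]] by fastforce
      qed
    qed
    then have "\<forall>\<^sub>F t in at_right 0. (\<Sum>x'\<in>X - {x}. z x' * visual_angle (a x') (b x') (m + of_real t * n)) +
        z x * visual_angle (a x) (b x) (m + of_real t * n) = 0"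
    proof eventually_elim
      case (elim t)
      then have "(\<Sum>x\<in>X. z x * visual_angle (a x) (b x) (m + of_real t * n)) = 0" by (intro zero) auto
      then show ?case
        using sum.remove[OF fin x(1), of "\<lambda>x. z x * visual_angle (a x) (b x) (m + of_real t * n)"] by simp
    qed
    ultimately have "((\<lambda>t::real. 0) \<longlongrightarrow> L + z x * l) (at_right 0)"
      by (rule Lim_transform_eventually)
    then have "0 = L + z x * l"
      by (subst (asm) tendsto_const_iff) (rule trivial_limit_at_right_real)
    then show ?thesis by simp
  qed
  have "L + z x * pi = 0" "L + z x * - pi = 0"
    by (rule *[OF disjI1[OF refl] visual_angle_limit_midpoint(1)[OF x(2), folded m_def h_def]],
        rule *[OF disjI2[OF refl] visual_angle_limit_midpoint(2)[OF x(2), folded m_def h_def]])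
  then show ?thesis by simp
qed

text \<open>Balance at \<open>v\<close> is the test against the indicator of \<open>v\<close>; on
  the finite set \<open>V\<close> every potential is a combination of such indicators.\<close>

lemma cycle_weights_vertexI:
  fixes a b :: "'x \<Rightarrow> complex"
  assumes "finite V" "finite X" "\<And>x. x \<in> X \<Longrightarrow> a x \<in> V \<and> b x \<in> V"
    and bal: "\<And>v. v \<in> V \<Longrightarrow> (\<Sum>x\<in>X. (of_bool (b x = v) - of_bool (a x = v)) * z x) = 0"
  shows "cycle_weights X a b z"
  unfolding cycle_weights_def
proof
  fix g :: "complex \<Rightarrow> complex"
  have "(\<Sum>x\<in>X. of_real (z x) * (g (b x) - g (a x))) =
      (\<Sum>x\<in>X. \<Sum>v\<in>V. g v * of_real ((of_bool (b x = v) - of_bool (a x = v)) * z x))"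
  proof (rule sum.cong[OF refl])
    fix x assume x: "x \<in> X"
    have pick: "(\<Sum>v\<in>V. g v * of_bool (c = v)) = g c" if "c \<in> V" for c
      using assms(1) that by (simp add: of_bool_def if_distrib[of "\<lambda>y. _ * y"] cong: if_cong)
    have "(\<Sum>v\<in>V. g v * of_real ((of_bool (b x = v) - of_bool (a x = v)) * z x)) =
        of_real (z x) * ((\<Sum>v\<in>V. g v * of_bool (b x = v)) - (\<Sum>v\<in>V. g v * of_bool (a x = v)))"
      unfolding sum_subtractf[symmetric] sum_distrib_left
      by (intro sum.cong refl) (simp add: algebra_simps)
    then show "of_real (z x) * (g (b x) - g (a x)) =
        (\<Sum>v\<in>V. g v * of_real ((of_bool (b x = v) - of_bool (a x = v)) * z x))"
      using pick assms(3)[OF x] by simp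
  qed
  also have "\<dots> = (\<Sum>v\<in>V. g v * of_real (\<Sum>x\<in>X. (of_bool (b x = v) - of_bool (a x = v)) * z x))"
    by (subst sum.swap) (simp only: sum_distrib_left[symmetric] of_real_sum)
  also have "\<dots> = 0" using bal by simp
  finally show "(\<Sum>x\<in>X. of_real (z x) * (g (b x) - g (a x))) = 0" .
qed

section \<open>Incidence of vertices, edges and quadrilaterals in a mesh\<close>

locale polygon_mesh =
  fixes P :: "complex list" and M :: "complex list set"
  assumes mesh: "quad_mesh P M"
begin

lemma mesh_quad:
  assumes "q \<in> M"
  shows "simple_polygon q" "length q = 4"
proof -
  have "\<forall>q\<in>M. length q = 4 \<and> simple_polygon q"
    using mesh unfolding quad_mesh_def by (elim conjE)
  then show "simple_polygon q" "length q = 4" using assms by simp_all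
qed

lemma mesh_finite: "finite M"
  using mesh unfolding quad_mesh_def by (elim conjE)

lemma mesh_cover: "(\<Union>q\<in>M. poly_region q) = poly_region P"
  using mesh unfolding quad_mesh_def by (elim conjE)

lemma mesh_meet:
  assumes "q1 \<in> M" "q2 \<in> M" "q1 \<noteq> q2" "x \<in> poly_region q1" "x \<in> poly_region q2"
  obtains "x \<in> set q1" "x \<in> set q2" "poly_region q1 \<inter> poly_region q2 = {x}"
  | i j where "i < 4" "j < 4" "pedge q1 i = pedge q2 j" "poly_region q1 \<inter> poly_region q2 = pedge q1 i"
    "x \<in> pedge q1 i"
proof -
  have "poly_region q1 \<inter> poly_region q2 = {} \<or>
        (\<exists>v. v \<in> set q1 \<and> v \<in> set q2 \<and> poly_region q1 \<inter> poly_region q2 = {v}) \<or>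
        (\<exists>i < 4. \<exists>j < 4. pedge q1 i = pedge q2 j \<and> poly_region q1 \<inter> poly_region q2 = pedge q1 i)"
    using mesh assms(1-3) unfolding quad_mesh_def by blast
  moreover have x: "x \<in> poly_region q1 \<inter> poly_region q2" using assms by blast
  ultimately consider v where "v \<in> set q1" "v \<in> set q2" "poly_region q1 \<inter> poly_region q2 = {v}"
    | i j where "i < 4" "j < 4" "pedge q1 i = pedge q2 j" "poly_region q1 \<inter> poly_region q2 = pedge q1 i"
    by blast
  then show thesis
  proof cases
    case 1
    have "x = v" using x[unfolded 1(3)] by simp
    then show ?thesis using 1 by (intro that(1)) simp_all
  next
    case 2
    have "x \<in> pedge q1 i" using x[unfolded 2(4)] .
    then show ?thesis using 2 by (intro that(2)[of i j])
  qed
qed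

lemma mesh_meet_segment:
  assumes "q1 \<in> M" "q2 \<in> M" "q1 \<noteq> q2"
  obtains x y where "poly_region q1 \<inter> poly_region q2 \<subseteq> closed_segment x y"
proof (cases "poly_region q1 \<inter> poly_region q2 = {}")
  case False
  then obtain z where "z \<in> poly_region q1" "z \<in> poly_region q2" by blast
  with assms show ?thesis
  proof (cases rule: mesh_meet)
    case 1
    then show ?thesis using that[of z z] by simp
  next
    case (2 i j)
    then show ?thesis using that[of "pv q1 i" "pv q1 (Suc i)"] by (simp add: pedge_def)
  qed
next
  case True
  then show ?thesis using that[of 0 0] by simp
qed

lemma mesh_pedge_region:
  assumes "q \<in> M" "i < 4"
  shows "pedge q i \<subseteq> poly_region q"
  using assms(2) mesh_quad(2)[OF assms(1)]
  by (intro order_trans[OF pedge_subset_boundary poly_boundary_subset_region]) simp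

lemma mesh_pv_set: "q \<in> M \<Longrightarrow> pv q i \<in> set q"
  by (rule pv_in_set) (use mesh_quad(2)[of q] in auto)

text \<open>There are no hanging vertices: a vertex lying on a shared edge is an end of that edge,
  and equal segments have equal ends.\<close>

lemma mesh_vertex:
  assumes "q1 \<in> M" "q2 \<in> M" "v \<in> set q1" "v \<in> poly_region q2"
  shows "v \<in> set q2"
proof (cases "q1 = q2")
  case False
  have "v \<in> poly_region q1"
    using vertex_in_boundary[OF assms(3)] poly_boundary_subset_region by blast
  from assms(1,2) False this assms(4) show ?thesis
  proof (cases rule: mesh_meet)
    case (2 i j)
    have "v \<in> {pv q1 i, pv q1 (Suc i)}"
      using vertex_in_pedge_endpoint[OF mesh_quad(1)[OF assms(1)] assms(3) _ 2(5)] 2(1) mesh_quad(2)[OF assms(1)]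
      by simp
    moreover have "{pv q1 i, pv q1 (Suc i)} = {pv q2 j, pv q2 (Suc j)}"
      using 2(3) unfolding pedge_def by (simp only: Starlike.closed_segment_eq)
    ultimately show ?thesis using mesh_pv_set[OF assms(2)] by auto
  qed
qed (use assms in simp)

definition mesh_vertices :: "complex set" where
  "mesh_vertices = (\<Union>q\<in>M. set q)"

text \<open>Edges are point sets, so an edge shared by two quadrilaterals is counted once, whatever
  its direction in each.\<close>

definition mesh_edges :: "complex set set" where
  "mesh_edges = (\<lambda>(q, i). pedge q i) ` (M \<times> {..<4})"

text \<open>An arbitrary choice of orientation for each edge.\<close>

definition edge_end :: "complex set \<Rightarrow> complex \<times> complex" where
  "edge_end e = (SOME (a, b). \<exists>q i. q \<in> M \<and> i < 4 \<and> e = pedge q i \<and> a = pv q i \<and> b = pv q (Suc i))"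

abbreviation "src e \<equiv> fst (edge_end e)"
abbreviation "tgt e \<equiv> snd (edge_end e)"

lemma mesh_edgesI: "q \<in> M \<Longrightarrow> i < 4 \<Longrightarrow> pedge q i \<in> mesh_edges"
  by (auto simp: mesh_edges_def)

lemma mesh_edge_ends:
  assumes "e \<in> mesh_edges"
  obtains q i where "q \<in> M" "i < 4" "e = pedge q i" "src e = pv q i" "tgt e = pv q (Suc i)"
proof -
  obtain q i where "q \<in> M" "i < 4" "e = pedge q i" using assms by (auto simp: mesh_edges_def)
  then have "case (pv q i, pv q (Suc i)) of (a, b) \<Rightarrow>
      \<exists>q i. q \<in> M \<and> i < 4 \<and> e = pedge q i \<and> a = pv q i \<and> b = pv q (Suc i)" by blast
  then have "case edge_end e of (a, b) \<Rightarrow>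
      \<exists>q i. q \<in> M \<and> i < 4 \<and> e = pedge q i \<and> a = pv q i \<and> b = pv q (Suc i)"
    unfolding edge_end_def by (rule someI)
  then show ?thesis using that by (auto simp: case_prod_beta)
qed

lemma mesh_edge:
  assumes "e \<in> mesh_edges"
  shows "e = closed_segment (src e) (tgt e)" "src e \<noteq> tgt e"
    "src e \<in> mesh_vertices" "tgt e \<in> mesh_vertices" "e \<subseteq> poly_region P"
proof -
  obtain q i where q: "q \<in> M" "i < 4" "e = pedge q i" "src e = pv q i" "tgt e = pv q (Suc i)"
    using mesh_edge_ends[OF assms] .
  show "e = closed_segment (src e) (tgt e)" using q by (simp add: pedge_def)
  show "src e \<noteq> tgt e" using pv_Suc_neq[OF mesh_quad(1)[OF q(1)], of i] q by metis
  show "src e \<in> mesh_vertices" "tgt e \<in> mesh_vertices"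
    using q mesh_pv_set[OF q(1)] by (auto simp: mesh_vertices_def)
  show "e \<subseteq> poly_region P" using mesh_pedge_region[OF q(1,2)] q(1,3) mesh_cover by blast
qed

text \<open>Within one quadrilateral, distinct edges meet only in ends. For two quadrilaterals, a
  common point that is not an end of \<open>e1\<close> forces a common edge, and this edge must be
  both \<open>e1\<close> and \<open>e2\<close>.\<close>

lemma mesh_edges_meet:
  assumes "e1 \<in> mesh_edges" "e2 \<in> mesh_edges" "x \<in> e1" "x \<in> e2" "x \<noteq> src e1" "x \<noteq> tgt e1"
  shows "e1 = e2"
proof -
  obtain q1 i where q1: "q1 \<in> M" "i < 4" "e1 = pedge q1 i" "src e1 = pv q1 i" "tgt e1 = pv q1 (Suc i)"
    using mesh_edge_ends[OF assms(1)] .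
  obtain q2 j where q2: "q2 \<in> M" "j < 4" "e2 = pedge q2 j" using assms(2) by (auto simp: mesh_edges_def)
  note s1 = mesh_quad[OF q1(1)] and s2 = mesh_quad[OF q2(1)]
  have x1: "x \<in> pedge q1 i" "x \<notin> {pv q1 i, pv q1 (Suc i)}" and x2: "x \<in> pedge q2 j"
    using assms q1 q2 by auto
  show ?thesis
  proof (cases "q1 = q2")
    case True
    then show ?thesis
      using pedge_Int_endpoint[OF s1(1), of i j x] s1(2) q1 q2 x1 x2 by metis
  next
    case False
    have "x \<in> poly_region q1" "x \<in> poly_region q2"
      using mesh_pedge_region q1(1,2) q2(1,2) x1 x2 by blast+
    with q1(1) q2(1) False show ?thesis
    proof (cases rule: mesh_meet)
      case 1
      then show ?thesis using vertex_in_pedge_endpoint[OF s1(1) 1(1) _ x1(1)] x1(2) q1(2) s1(2) by metis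
    next
      case (2 i' j')
      have "i' = i"
        using pedge_Int_endpoint[OF s1(1), of i i' x] s1(2) q1(2) 2(1,5) x1 by metis
      then have e: "pedge q1 i = pedge q2 j'" using 2 by simp
      then have "{pv q1 i, pv q1 (Suc i)} = {pv q2 j', pv q2 (Suc j')}"
        unfolding pedge_def by (simp only: Starlike.closed_segment_eq)
      then have "j' = j"
        using pedge_Int_endpoint[OF s2(1), of j' j x] s2(2) q2(2) 2(2) x1 x2 e by metis
      then show ?thesis using e q1 q2 by simp
    qed
  qed
qed

text \<open>Distinct quadrilaterals may meet only in a vertex or an edge, hence only on their
  boundaries.\<close>

lemma mesh_edge_inside:
  assumes "q \<in> M" "e \<in> mesh_edges"
  shows "inside (poly_boundary q) \<inter> e = {}"
proof (rule ccontr)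
  assume "inside (poly_boundary q) \<inter> e \<noteq> {}"
  then obtain x where x: "x \<in> inside (poly_boundary q)" "x \<in> e" by blast
  have nb: "x \<notin> poly_boundary q" using x(1) inside_no_overlap by blast
  obtain q' j where q': "q' \<in> M" "j < 4" "e = pedge q' j" using assms(2) by (auto simp: mesh_edges_def)
  have sub: "pedge q i \<subseteq> poly_boundary q" if "i < 4" for i
    using pedge_subset_boundary[of i q] mesh_quad(2)[OF assms(1)] that by simp
  show False
  proof (cases "q' = q")
    case True
    then show False using sub[OF q'(2)] q' x nb by blast
  next
    case False
    have "x \<in> poly_region q" "x \<in> poly_region q'"
      using x mesh_pedge_region[OF q'(1,2)] q'(3) by (auto simp: poly_region_def)
    with assms(1) q'(1) False[symmetric] show False
      by (cases rule: mesh_meet) (use nb sub vertex_in_boundary[of x q] in auto)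
  qed
qed

lemma finite_mesh_edges: "finite mesh_edges"
  using mesh_finite by (simp add: mesh_edges_def)

lemma finite_mesh_vertices: "finite mesh_vertices"
  using mesh_finite by (simp add: mesh_vertices_def)

text \<open>Off the edges the angle sum vanishes everywhere: outside \<open>P\<close> because that
  region reaches infinity, and inside each quadrilateral by constancy from the sample point
  \<open>c q\<close>. The jump at the midpoint of \<open>e\<close> then kills its weight.\<close>

lemma mesh_cycle_zero:
  assumes P: "simple_polygon P"
    and cyc: "cycle_weights mesh_edges src tgt z"
    and c: "\<And>q. q \<in> M \<Longrightarrow> c q \<in> inside (poly_boundary q)"
      "\<And>q. q \<in> M \<Longrightarrow> (\<Sum>e\<in>mesh_edges. z e * visual_angle (src e) (tgt e) (c q)) = 0"
    and e: "e \<in> mesh_edges"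
  shows "z e = 0"
proof (rule cycle_weight_zero[OF finite_mesh_edges e, of src tgt])
  show "src e \<noteq> tgt e" using mesh_edge[OF e] by simp
  have mid: "(src e + tgt e) / 2 \<in> e" "(src e + tgt e) / 2 \<noteq> src e" "(src e + tgt e) / 2 \<noteq> tgt e"
  proof -
    have "midpoint (src e) (tgt e) \<in> closed_segment (src e) (tgt e)" by simp
    then show "(src e + tgt e) / 2 \<in> e"
      using mesh_edge(1)[OF e] by (simp add: midpoint_def scaleR_conv_of_real)
  qed (use mesh_edge(2)[OF e] in \<open>auto simp: field_simps\<close>)
  show "(src e + tgt e) / 2 \<notin> closed_segment (src e') (tgt e')" if "e' \<in> mesh_edges" "e' \<noteq> e" for e'
    using mesh_edges_meet[OF e that(1) mid(1) _ mid(2,3)] mesh_edge(1)[OF that(1)] that(2) by blast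
next
  fix p assume off: "\<And>e. e \<in> mesh_edges \<Longrightarrow> p \<notin> closed_segment (src e) (tgt e)"
  show "(\<Sum>e\<in>mesh_edges. z e * visual_angle (src e) (tgt e) p) = 0"
  proof (cases "p \<in> poly_region P")
    case False
    have S: "outside (poly_boundary P) = - poly_region P" by (simp add: compl_poly_region)
    show ?thesis
    proof (rule cycle_angle_zero[OF cyc poly_Jordan(5,6)[OF P]])
      show "bounded (- outside (poly_boundary P))"
        using poly_Jordan(3)[OF P] compact_imp_bounded[OF compact_poly_boundary]
        by (simp add: S poly_region_def)
      show "p \<in> outside (poly_boundary P)" using False S by simp
      show "outside (poly_boundary P) \<inter> closed_segment (src e) (tgt e) = {}" if "e \<in> mesh_edges" for e
        using mesh_edge(1,5)[OF that] S by auto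
    qed
  next
    case True
    then obtain q where q: "q \<in> M" "p \<in> poly_region q" using mesh_cover by blast
    have "p \<notin> pedge q i" if "i < 4" for i
      using off[OF mesh_edgesI[OF q(1) that]] mesh_edge(1)[OF mesh_edgesI[OF q(1) that]] by simp
    then have "p \<notin> poly_boundary q" using mesh_quad(2)[OF q(1)] by (simp add: poly_boundary_def)
    then have p: "p \<in> inside (poly_boundary q)" using q(2) by (simp add: poly_region_def)
    note J = poly_Jordan(4,2)[OF mesh_quad(1)[OF q(1)]]
    have "(\<lambda>p. \<Sum>e\<in>mesh_edges. z e * visual_angle (src e) (tgt e) p) constant_on inside (poly_boundary q)"
      using mesh_edge_inside[OF q(1)] mesh_edge(1) by (intro cycle_angle_const[OF cyc J]) metis
    then show ?thesis using p c[OF q(1)] unfolding constant_on_def by metis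
  qed
qed

text \<open>Otherwise a linear system with one unknown per edge has fewer equations than unknowns:
  balance at every vertex but one, and a zero angle sum at one point of each quadrilateral. A
  nonzero solution contradicts \<open>mesh_cycle_zero\<close>.\<close>

lemma mesh_Euler:
  assumes P: "simple_polygon P"
  shows "card mesh_edges < card mesh_vertices + card M"
proof (rule ccontr)
  assume "\<not> ?thesis"
  then have ge: "card mesh_vertices + card M \<le> card mesh_edges" by simp
  have "M \<noteq> {}"
    using mesh_cover poly_Jordan(1)[OF P] by (auto simp: poly_region_def)
  then obtain q0 where q0: "q0 \<in> M" by blast
  \<comment> \<open>The balance equation at this vertex is left out of the system, which makes the
    inequality between equations and unknowns strict.\<close>
  define v0 where "v0 = pv q0 0"
  have v0: "v0 \<in> mesh_vertices" using q0 mesh_pv_set[OF q0] by (auto simp: v0_def mesh_vertices_def)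
  define c where "c q = (SOME p. p \<in> inside (poly_boundary q))" for q
  have c: "c q \<in> inside (poly_boundary q)" if "q \<in> M" for q
    unfolding c_def some_in_eq by (rule poly_Jordan(1)[OF mesh_quad(1)[OF that]])
  let ?Y = "(mesh_vertices - {v0}) <+> M"
  define A where "A y e = (case y of Inl v \<Rightarrow> of_bool (tgt e = v) - of_bool (src e = v)
    | Inr q \<Rightarrow> visual_angle (src e) (tgt e) (c q))" for y :: "complex + complex list" and e
  have "card mesh_vertices > 0" using v0 finite_mesh_vertices card_gt_0_iff by blast
  then have "card ?Y < card mesh_edges"
    using ge v0 finite_mesh_vertices mesh_finite by (simp add: card_Plus)
  moreover have "finite ?Y" using finite_mesh_vertices mesh_finite by simp
  ultimately obtain z where z: "\<exists>e\<in>mesh_edges. z e \<noteq> 0" "\<And>y. y \<in> ?Y \<Longrightarrow> (\<Sum>e\<in>mesh_edges. A y e * z e) = 0"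
    using ex_nonzero_solution[OF finite_mesh_edges, of ?Y A] by blast
  let ?b = "\<lambda>v. \<Sum>e\<in>mesh_edges. (of_bool (tgt e = v) - of_bool (src e = v)) * z e"
  have b1: "?b v = 0" if "v \<in> mesh_vertices - {v0}" for v
    using z(2)[OF InlI[OF that]] by (simp add: A_def)
  \<comment> \<open>Each edge enters the total balance once with each sign, so the balance at
    \<open>v0\<close> follows from the others.\<close>
  have "(\<Sum>v\<in>mesh_vertices. ?b v) = (\<Sum>e\<in>mesh_edges. \<Sum>v\<in>mesh_vertices. (of_bool (tgt e = v) - of_bool (src e = v)) * z e)"
    by (rule sum.swap)
  also have "\<dots> = 0"
  proof (rule sum.neutral, rule ballI)
    fix e assume e: "e \<in> mesh_edges"
    have "(\<Sum>v\<in>mesh_vertices. of_bool (w = v)) = (1::real)" if "w \<in> mesh_vertices" for w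
      using finite_mesh_vertices that by (simp add: of_bool_def)
    then show "(\<Sum>v\<in>mesh_vertices. (of_bool (tgt e = v) - of_bool (src e = v)) * z e) = 0"
      using mesh_edge(3,4)[OF e] by (simp add: sum_subtractf flip: sum_distrib_right)
  qed
  finally have "?b v0 = 0"
    using sum.remove[OF finite_mesh_vertices v0, of ?b] sum.neutral[of "mesh_vertices - {v0}" ?b] b1 by simp
  then have "cycle_weights mesh_edges src tgt z"
    using b1 mesh_edge(3,4)
    by (intro cycle_weights_vertexI[OF finite_mesh_vertices finite_mesh_edges]) auto
  moreover have "(\<Sum>e\<in>mesh_edges. z e * visual_angle (src e) (tgt e) (c q)) = 0" if "q \<in> M" for q
    using z(2)[OF InrI[OF that]] by (simp add: A_def mult.commute)
  ultimately have "\<And>e. e \<in> mesh_edges \<Longrightarrow> z e = 0"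
    using mesh_cycle_zero[OF P _ c] by blast
  then show False using z(1) by blast
qed

end

section \<open>Counting at a mesh vertex\<close>

context polygon_mesh
begin

definition quads_at :: "complex \<Rightarrow> complex list set" where
  "quads_at v = {q \<in> M. v \<in> set q}"

definition edges_at :: "complex \<Rightarrow> complex set set" where
  "edges_at v = {e \<in> mesh_edges. v = src e \<or> v = tgt e}"

definition corner_index :: "complex \<Rightarrow> complex list \<Rightarrow> nat" where
  "corner_index v q = (SOME i. i < 4 \<and> pv q i = v)"

definition first_dir :: "complex \<Rightarrow> complex list \<Rightarrow> complex" where
  "first_dir v q = corner_first q (corner_index v q)"

definition last_dir :: "complex \<Rightarrow> complex list \<Rightarrow> complex" where
  "last_dir v q = corner_last q (corner_index v q)"

lemma corner_index:
  assumes "q \<in> quads_at v"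
  shows "corner_index v q < 4" "pv q (corner_index v q) = v"
proof -
  have "q \<in> M" "v \<in> set q" using assms by (auto simp: quads_at_def)
  then have "\<exists>i. i < 4 \<and> pv q i = v"
    using mesh_quad(2)[of q] by (metis in_set_conv_nth pv_eq_nth)
  then have "corner_index v q < 4 \<and> pv q (corner_index v q) = v"
    unfolding corner_index_def by (rule someI_ex)
  then show "corner_index v q < 4" "pv q (corner_index v q) = v" by auto
qed

text \<open>The corner facts restated with directions at \<open>v\<close> in place of vertex
  indices, which makes different quadrilaterals at \<open>v\<close> comparable.\<close>

lemma quad_corner:
  assumes q: "q \<in> quads_at v"
  shows "first_dir v q \<noteq> 0" "last_dir v q \<noteq> 0" "0 < Arg2pi (last_dir v q / first_dir v q)"
    "closed_segment v (v + first_dir v q) \<in> mesh_edges"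
    "closed_segment v (v + last_dir v q) \<in> mesh_edges"
    "Arg2pi (last_dir v q / first_dir v q) = interior_angle q (corner_index v q)"
    "\<And>n. n \<noteq> 0 \<Longrightarrow> 0 < Arg2pi (n / first_dir v q) \<Longrightarrow>
      Arg2pi (n / first_dir v q) < Arg2pi (last_dir v q / first_dir v q) \<Longrightarrow>
      \<forall>\<^sub>F t in at_right 0. v + of_real t * n \<in> poly_region q"
    "\<And>n. n \<noteq> 0 \<Longrightarrow> Arg2pi (last_dir v q / first_dir v q) < Arg2pi (n / first_dir v q) \<Longrightarrow>
      \<forall>\<^sub>F t in at_right 0. v + of_real t * n \<notin> poly_region q"
proof -
  have M: "q \<in> M" using q by (simp add: quads_at_def)
  note sq = mesh_quad[OF M]
  note ix = corner_index[OF q]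
  have i: "corner_index v q < length q" using ix(1) sq(2) by simp
  note cs = corner_sector[OF sq(1) i, unfolded ix(2)]
  show ang: "Arg2pi (last_dir v q / first_dir v q) = interior_angle q (corner_index v q)"
    by (simp add: interior_angle_eq first_dir_def last_dir_def)
  show "first_dir v q \<noteq> 0" "last_dir v q \<noteq> 0" "0 < Arg2pi (last_dir v q / first_dir v q)"
    unfolding ang using cs(1,2,3) by (simp_all add: first_dir_def last_dir_def)
  obtain j k where jk: "j < length q" "k < length q"
    "closed_segment v (v + first_dir v q) = pedge q j" "closed_segment v (v + last_dir v q) = pedge q k"
    using corner_edges[OF sq(1) i] unfolding ix(2) first_dir_def last_dir_def by metis
  show "closed_segment v (v + first_dir v q) \<in> mesh_edges" "closed_segment v (v + last_dir v q) \<in> mesh_edges"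
    using mesh_edgesI[OF M] jk sq(2) by simp_all
  show "\<forall>\<^sub>F t in at_right 0. v + of_real t * n \<in> poly_region q"
    if "n \<noteq> 0" "0 < Arg2pi (n / first_dir v q)"
      "Arg2pi (n / first_dir v q) < Arg2pi (last_dir v q / first_dir v q)" for n
  proof -
    have "\<forall>\<^sub>F t in at_right 0. v + of_real t * n \<in> inside (poly_boundary q)"
      using cs(4)[of n, folded first_dir_def] that unfolding ang by blast
    then show ?thesis by (rule eventually_mono) (simp add: poly_region_def)
  qed
  show "\<forall>\<^sub>F t in at_right 0. v + of_real t * n \<notin> poly_region q"
    if "n \<noteq> 0" "Arg2pi (last_dir v q / first_dir v q) < Arg2pi (n / first_dir v q)" for n
  proof -
    have "\<forall>\<^sub>F t in at_right 0. v + of_real t * n \<in> outside (poly_boundary q)"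
      using cs(5)[of n, folded first_dir_def] that unfolding ang by blast
    then show ?thesis by (rule eventually_mono) (simp add: compl_poly_region[symmetric])
  qed
qed

text \<open>The orientation of an edge is arbitrary, but the sum of its ends is not: subtracting
  \<open>v\<close> recovers the far end.\<close>

lemma mesh_edge_at:
  assumes "closed_segment v x \<in> mesh_edges"
  shows "closed_segment v x \<in> edges_at v"
    "src (closed_segment v x) + tgt (closed_segment v x) = v + x"
proof -
  let ?e = "closed_segment v x"
  have "closed_segment v x = closed_segment (src ?e) (tgt ?e)" by (rule mesh_edge(1)[OF assms])
  then have "{v, x} = {src ?e, tgt ?e}" by (simp only: Starlike.closed_segment_eq)
  then have d: "(v = src ?e \<and> x = tgt ?e) \<or> (v = tgt ?e \<and> x = src ?e)" by (auto simp: doubleton_eq_iff)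
  then show "src ?e + tgt ?e = v + x" by auto
  show "?e \<in> edges_at v" unfolding edges_at_def using assms d by blast
qed

text \<open>Distinct quadrilaterals meet within a segment, which cannot contain initial pieces of
  rays in two nonparallel directions.\<close>

lemma quads_overlap_eq:
  assumes q: "q1 \<in> quads_at v" "q2 \<in> quads_at v" and n: "n \<noteq> 0" "Im (m / n) \<noteq> 0"
    and ev: "\<And>q. q \<in> {q1, q2} \<Longrightarrow> \<forall>\<^sub>F t in at_right 0. v + of_real t * n \<in> poly_region q"
      "\<And>q. q \<in> {q1, q2} \<Longrightarrow> \<forall>\<^sub>F t in at_right 0. v + of_real t * m \<in> poly_region q"
  shows "q1 = q2"
proof (rule ccontr)
  assume ne: "q1 \<noteq> q2"
  have M: "q1 \<in> M" "q2 \<in> M" using q by (auto simp: quads_at_def)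
  obtain x y where xy: "poly_region q1 \<inter> poly_region q2 \<subseteq> closed_segment x y"
    using mesh_meet_segment[OF M ne] .
  have "v \<in> poly_region q1 \<inter> poly_region q2"
    using q vertex_in_boundary poly_boundary_subset_region by (auto simp: quads_at_def)
  from directions_in_segment[OF xy this n(1)] show False
    using ev n(2) by (simp add: eventually_conj_iff)
qed

text \<open>Both quadrilaterals contain the narrower of the two sectors that start at the common
  direction.\<close>

lemma first_dir_inj:
  assumes q: "q1 \<in> quads_at v" "q2 \<in> quads_at v" and eq: "first_dir v q1 = first_dir v q2"
  shows "q1 = q2"
proof -
  define u where "u = first_dir v q1"
  define \<alpha> where "\<alpha> = min (Arg2pi (last_dir v q1 / u)) (Arg2pi (last_dir v q2 / u))"
  have \<alpha>: "0 < \<alpha>" "\<alpha> < 2 * pi"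
    using quad_corner(3)[OF q(1)] quad_corner(3)[OF q(2)] eq Arg2pi_lt_2pi[of "last_dir v q1 / u"]
    by (auto simp: \<alpha>_def u_def)
  have u: "u \<noteq> 0" using quad_corner(1)[OF q(1)] by (simp add: u_def)
  have ev: "\<forall>\<^sub>F t in at_right 0. v + of_real t * (u * cis x) \<in> poly_region q"
    if "q \<in> {q1, q2}" "0 < x" "x < \<alpha>" for q x
  proof (rule quad_corner(7))
    have uq: "first_dir v q = u" using that eq by (auto simp: u_def)
    have a: "Arg2pi (u * cis x / first_dir v q) = x" using uq u that \<alpha> by (simp add: Arg2pi_cis)
    show "q \<in> quads_at v" using that q by auto
    show "u * cis x \<noteq> 0" using u by simp
    show "0 < Arg2pi (u * cis x / first_dir v q)" using a that by simp
    show "Arg2pi (u * cis x / first_dir v q) < Arg2pi (last_dir v q / first_dir v q)"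
      unfolding a unfolding uq using that by (auto simp: \<alpha>_def)
  qed
  \<comment> \<open>The test directions at \<open>\<alpha> / 4\<close> and
    \<open>\<alpha> / 2\<close> lie in both sectors; they are not parallel because
    \<open>0 < \<alpha> / 4 < pi\<close>.\<close>
  have "(u * cis (\<alpha> / 2)) / (u * cis (\<alpha> / 4)) = cis (\<alpha> / 4)"
    using u by (simp add: cis_divide)
  moreover have "sin (\<alpha> / 4) > 0" using \<alpha> by (intro sin_gt_zero) auto
  ultimately have "Im ((u * cis (\<alpha> / 2)) / (u * cis (\<alpha> / 4))) \<noteq> 0" by simp
  then show ?thesis
    using quads_overlap_eq[OF q, of "u * cis (\<alpha> / 4)" "u * cis (\<alpha> / 2)"] u \<alpha> ev by auto
qed

text \<open>The same overlap, now turning clockwise from the common last direction; hence the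
  divisions by \<open>cis x\<close>.\<close>

lemma last_dir_inj:
  assumes q: "q1 \<in> quads_at v" "q2 \<in> quads_at v" and eq: "last_dir v q1 = last_dir v q2"
  shows "q1 = q2"
proof -
  define w where "w = last_dir v q1"
  define \<alpha> where "\<alpha> = min (Arg2pi (w / first_dir v q1)) (Arg2pi (w / first_dir v q2))"
  have \<alpha>: "0 < \<alpha>" "\<alpha> < 2 * pi"
    using quad_corner(3)[OF q(1)] quad_corner(3)[OF q(2)] eq Arg2pi_lt_2pi[of "w / first_dir v q1"]
    by (auto simp: \<alpha>_def w_def)
  have w: "w \<noteq> 0" using quad_corner(2)[OF q(1)] by (simp add: w_def)
  have ev: "\<forall>\<^sub>F t in at_right 0. v + of_real t * (w / cis x) \<in> poly_region q"
    if x: "q \<in> {q1, q2}" "0 < x" "x < \<alpha>" for q x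
  proof (rule quad_corner(7))
    have wq: "last_dir v q = w" using x eq by (auto simp: w_def)
    show qq: "q \<in> quads_at v" using x q by auto
    have le: "x < Arg2pi (w / first_dir v q)" using x by (auto simp: \<alpha>_def)
    have "Arg2pi (w / first_dir v q / cis x) = Arg2pi (w / first_dir v q) - x"
      using w quad_corner(1)[OF qq] le x \<alpha>
        Arg2pi_quotient[of "w / first_dir v q" "cis x"] Arg2pi_cis[of x] by simp
    then have a: "Arg2pi (w / cis x / first_dir v q) = Arg2pi (w / first_dir v q) - x"
      by (simp add: mult.commute)
    show "w / cis x \<noteq> 0" using w by simp
    show "0 < Arg2pi (w / cis x / first_dir v q)" using a le by simp
    show "Arg2pi (w / cis x / first_dir v q) < Arg2pi (last_dir v q / first_dir v q)"
      unfolding a wq using x by simp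
  qed
  have "(w / cis (\<alpha> / 4)) / (w / cis (\<alpha> / 2)) = cis (\<alpha> / 2) / cis (\<alpha> / 4)"
    using w by simp
  then have "(w / cis (\<alpha> / 4)) / (w / cis (\<alpha> / 2)) = cis (\<alpha> / 4)"
    by (simp add: cis_divide)
  moreover have "sin (\<alpha> / 4) > 0" using \<alpha> by (intro sin_gt_zero) auto
  ultimately have "Im ((w / cis (\<alpha> / 4)) / (w / cis (\<alpha> / 2))) \<noteq> 0" by simp
  then show ?thesis
    using quads_overlap_eq[OF q, of "w / cis (\<alpha> / 2)" "w / cis (\<alpha> / 4)"] w \<alpha> ev by auto
qed

lemma finite_at: "finite (quads_at v)" "finite (edges_at v)"
  using mesh_finite finite_mesh_edges by (auto simp: quads_at_def edges_at_def)

lemma inj_first_edge: "inj_on (\<lambda>q. closed_segment v (v + first_dir v q)) (quads_at v)"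
proof (rule inj_onI)
  fix q1 q2 assume q: "q1 \<in> quads_at v" "q2 \<in> quads_at v"
    and "closed_segment v (v + first_dir v q1) = closed_segment v (v + first_dir v q2)"
  then have "{v, v + first_dir v q1} = {v, v + first_dir v q2}"
    by (simp only: Starlike.closed_segment_eq)
  then have "first_dir v q1 = first_dir v q2" by (auto simp: doubleton_eq_iff)
  then show "q1 = q2" using first_dir_inj[OF q] by blast
qed

lemma inj_last_edge: "inj_on (\<lambda>q. closed_segment v (v + last_dir v q)) (quads_at v)"
proof (rule inj_onI)
  fix q1 q2 assume q: "q1 \<in> quads_at v" "q2 \<in> quads_at v"
    and "closed_segment v (v + last_dir v q1) = closed_segment v (v + last_dir v q2)"
  then have "{v, v + last_dir v q1} = {v, v + last_dir v q2}"
    by (simp only: Starlike.closed_segment_eq)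
  then have "last_dir v q1 = last_dir v q2" by (auto simp: doubleton_eq_iff)
  then show "q1 = q2" using last_dir_inj[OF q] by blast
qed

lemma quads_at_le_edges_at: "card (quads_at v) \<le> card (edges_at v)"
  using quad_corner(4) mesh_edge_at(1)
  by (intro card_inj_on_le[OF inj_first_edge _ finite_at(2)]) auto

text \<open>The first edges and the last edges both exhaust the edges at \<open>v\<close>, so the quotients of last by
  first direction have product 1.\<close>

lemma full_angle:
  assumes eq: "card (quads_at v) = card (edges_at v)" and ne: "quads_at v \<noteq> {}"
  shows "2 * pi \<le> (\<Sum>q\<in>quads_at v. Arg2pi (last_dir v q / first_dir v q))"
proof -
  let ?D = "quads_at v"
  let ?\<alpha> = "\<lambda>q. Arg2pi (last_dir v q / first_dir v q)"
  \<comment> \<open>\<open>src e + tgt e - v - v\<close> is the direction vector of \<open>e\<close>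
    seen from \<open>v\<close>. The right-hand side does not mention \<open>d\<close>, so first and
    last directions have equal products.\<close>
  have pr: "(\<Prod>q\<in>?D. d q) = (\<Prod>e\<in>edges_at v. src e + tgt e - v - v)"
    if inj: "inj_on (\<lambda>q. closed_segment v (v + d q)) ?D"
      and d: "\<And>q. q \<in> ?D \<Longrightarrow> closed_segment v (v + d q) \<in> mesh_edges" for d
  proof -
    have "(\<lambda>q. closed_segment v (v + d q)) ` ?D = edges_at v"
    proof (rule card_subset_eq[OF finite_at(2)])
      show "(\<lambda>q. closed_segment v (v + d q)) ` ?D \<subseteq> edges_at v" using d mesh_edge_at(1) by blast
      show "card ((\<lambda>q. closed_segment v (v + d q)) ` ?D) = card (edges_at v)"
        using card_image[OF inj] eq by simp
    qed
    then have "(\<Prod>e\<in>edges_at v. src e + tgt e - v - v) =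
        (\<Prod>q\<in>?D. src (closed_segment v (v + d q)) + tgt (closed_segment v (v + d q)) - v - v)"
      using prod.reindex[OF inj, of "\<lambda>e. src e + tgt e - v - v"] by (simp add: o_def)
    also have "\<dots> = (\<Prod>q\<in>?D. d q)"
      by (intro prod.cong refl) (simp add: mesh_edge_at(2)[OF d])
    finally show ?thesis by simp
  qed
  have "(\<Prod>q\<in>?D. first_dir v q) = (\<Prod>q\<in>?D. last_dir v q)"
    using pr[of "first_dir v"] pr[of "last_dir v"] inj_first_edge[of v] inj_last_edge[of v] quad_corner(4,5) by simp
  moreover have nz: "(\<Prod>q\<in>?D. first_dir v q) \<noteq> 0"
    using quad_corner(1) finite_at(1) by simp
  ultimately have one: "(\<Prod>q\<in>?D. last_dir v q / first_dir v q) = 1"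
    by (simp add: prod_dividef)
  \<comment> \<open>In polar form the moduli multiply to 1 as well, so only the exponential of the
    angle sum remains.\<close>
  have "(\<Prod>q\<in>?D. last_dir v q / first_dir v q) =
      (\<Prod>q\<in>?D. of_real (cmod (last_dir v q / first_dir v q)) * exp (\<i> * of_real (?\<alpha> q)))"
    by (intro prod.cong refl) (rule Arg2pi_eq)
  also have "\<dots> = of_real (\<Prod>q\<in>?D. cmod (last_dir v q / first_dir v q)) * exp (\<i> * of_real (\<Sum>q\<in>?D. ?\<alpha> q))"
    by (simp add: prod.distrib exp_sum[OF finite_at(1)] sum_distrib_left)
  also have "(\<Prod>q\<in>?D. cmod (last_dir v q / first_dir v q)) = 1"
    using arg_cong[OF one, of cmod] by (simp only: prod_norm norm_one)
  finally have "exp (\<i> * of_real (\<Sum>q\<in>?D. ?\<alpha> q)) = 1" using one by simp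
  then obtain k :: int where k: "(\<Sum>q\<in>?D. ?\<alpha> q) = of_int (2 * k) * pi"
    by (auto simp: exp_eq_1)
  have "0 < (\<Sum>q\<in>?D. ?\<alpha> q)" using quad_corner(3) ne finite_at(1) by (intro sum_pos) auto
  then have "0 < k" unfolding k by (simp add: zero_less_mult_iff)
  then have "1 * (2 * pi) \<le> of_int k * (2 * pi)" by (intro mult_right_mono) auto
  then show ?thesis unfolding k by (simp add: algebra_simps)
qed

section \<open>Every mesh vertex lies in at least two quadrilaterals\<close>

text \<open>Every direction into \<open>P\<close> lies within \<open>2 * pi / 3\<close>
  counterclockwise of the first edge of \<open>q\<close>. The angle from one such direction to
  another is then below \<open>2 * pi / 3\<close> or above \<open>4 * pi / 3\<close>, depending on
  their order.\<close>

lemma single_quad_sector: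
  assumes q: "quads_at v = {q}"
    and \<alpha>: "Arg2pi (last_dir v q / first_dir v q) < 2 * pi / 3"
    and n: "n1 \<noteq> 0" "n2 \<noteq> 0"
    and ev: "\<forall>\<^sub>F t in at_right 0. v + of_real t * n1 \<in> poly_region P"
      "\<forall>\<^sub>F t in at_right 0. v + of_real t * n2 \<in> poly_region P"
  shows "\<not> (2 * pi / 3 \<le> Arg2pi (n2 / n1) \<and> Arg2pi (n2 / n1) \<le> 4 * pi / 3)"
proof -
  have qq: "q \<in> quads_at v" using q by simp
  have v: "v \<in> set q" "q \<in> M" using qq by (auto simp: quads_at_def)
  \<comment> \<open>Along any other direction, points near \<open>v\<close> leave \<open>q\<close>.
    They also avoid the remaining quadrilaterals, which are closed and do not contain
    \<open>v\<close>, so nothing covers them.\<close>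
  have narrow: "Arg2pi (n / first_dir v q) < 2 * pi / 3"
    if n: "n \<noteq> 0" and evn: "\<forall>\<^sub>F t in at_right 0. v + of_real t * n \<in> poly_region P" for n
  proof (rule ccontr)
    assume "\<not> ?thesis"
    then have "\<forall>\<^sub>F t in at_right 0. v + of_real t * n \<notin> poly_region q"
      using quad_corner(8)[OF qq n] \<alpha> by linarith
    moreover have "\<forall>\<^sub>F t in at_right 0. \<forall>q'\<in>M - {q}. v + of_real t * n \<notin> poly_region q'"
    proof (rule eventually_ball_finite)
      show "finite (M - {q})" using mesh_finite by simp
      show "\<forall>q'\<in>M - {q}. \<forall>\<^sub>F t in at_right 0. v + of_real t * n \<notin> poly_region q'"
      proof
        fix q' assume q': "q' \<in> M - {q}"
        then have "q' \<notin> quads_at v" using q by simp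
        then have "v \<notin> poly_region q'" using mesh_vertex[OF v(2) _ v(1), of q'] q' by (auto simp: quads_at_def)
        moreover have "open (- poly_region q')"
          using closed_poly_region[OF mesh_quad(1), of q'] q' by auto
        moreover have "((\<lambda>t::real. v + of_real t * n) \<longlongrightarrow> v) (at_right 0)"
          by (rule tendsto_eq_intros refl | simp)+
        ultimately show "\<forall>\<^sub>F t in at_right 0. v + of_real t * n \<notin> poly_region q'"
          using topological_tendstoD[of "\<lambda>t::real. v + of_real t * n" v "at_right 0" "- poly_region q'"] by simp
      qed
    qed
    ultimately have "\<forall>\<^sub>F t in at_right (0::real). False"
      using evn
    proof eventually_elim
      case (elim t)
      then show ?case using mesh_cover by blast
    qed
    then show False by simp
  qed
  have u: "first_dir v q \<noteq> 0" by (rule quad_corner(1)[OF qq])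
  have "Arg2pi (n2 / n1) = Arg2pi ((n2 / first_dir v q) / (n1 / first_dir v q))" using u by simp
  then show ?thesis
    using Arg2pi_quotient[of "n2 / first_dir v q" "n1 / first_dir v q"] n u
      narrow[OF n(1) ev(1)] narrow[OF n(2) ev(2)]
      Arg2pi_ge_0[of "n1 / first_dir v q"] Arg2pi_ge_0[of "n2 / first_dir v q"]
    by (auto split: if_splits)
qed

text \<open>With a single quadrilateral at \<open>v\<close>, no two directions into \<open>P\<close>
  may form an angle from \<open>2 * pi / 3\<close> to \<open>4 * pi / 3\<close>. Such a pair always
  exists: opposite directions inside \<open>P\<close> or along an edge, and at a corner either the
  two edges or, if the angle is reflex, one edge direction and its opposite.\<close>

lemma two_quads_at:
  assumes P: "simple_polygon P" and angP: "\<And>i. i < length P \<Longrightarrow> 2 * pi / 3 \<le> interior_angle P i"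
    and angM: "\<And>q i. q \<in> M \<Longrightarrow> i < 4 \<Longrightarrow> interior_angle q i < 2 * pi / 3"
    and v: "v \<in> mesh_vertices"
  shows "2 \<le> card (quads_at v)"
proof (rule ccontr)
  assume "\<not> ?thesis"
  moreover obtain q where q: "q \<in> quads_at v" using v by (auto simp: mesh_vertices_def quads_at_def)
  then have "card (quads_at v) \<noteq> 0" using finite_at(1) by auto
  ultimately have "card (quads_at v) = 1" by linarith
  then obtain q' where "quads_at v = {q'}" by (rule card_1_singletonE)
  then have single: "quads_at v = {q}" using q by simp
  have qM: "q \<in> M" using q by (simp add: quads_at_def)
  have \<alpha>: "Arg2pi (last_dir v q / first_dir v q) < 2 * pi / 3"
    unfolding quad_corner(6)[OF q] by (rule angM[OF qM corner_index(1)[OF q]])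
  note no = single_quad_sector[OF single \<alpha>]
  have opp: "Arg2pi (- n / n) = pi" if "n \<noteq> 0" for n using that Arg2pi_of_real[of "-1"] by simp
  have no_opp: False
    if "n \<noteq> 0" "\<forall>\<^sub>F t in at_right 0. v + of_real t * n \<in> poly_region P"
      "\<forall>\<^sub>F t in at_right 0. v + of_real t * (- n) \<in> poly_region P" for n
  proof -
    have "- n \<noteq> 0" using that(1) by simp
    from no[OF that(1) this that(2,3)] show False unfolding opp[OF that(1)] by simp
  qed
  have along: "\<forall>\<^sub>F t in at_right 0. v + of_real t * n \<in> poly_region P"
    if i: "i < length P" and n: "closed_segment v (v + of_real s * n) \<subseteq> pedge P i" and s: "0 < s" for i n s
    using eventually_at_right_less[of "0::real"] eventually_at_right_real[OF s]
  proof eventually_elim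
    case (elim t)
    have "v + of_real t * n \<in> closed_segment v (v + of_real s * n)"
      unfolding in_segment using elim s
      by (intro exI[of _ "t / s"]) (auto simp: scaleR_conv_of_real algebra_simps)
    then show ?case using n pedge_subset_boundary[OF i] poly_boundary_subset_region by blast
  qed
  have vP: "v \<in> poly_region P"
    using q vertex_in_boundary[of v q] poly_boundary_subset_region[of q] mesh_cover
    by (auto simp: quads_at_def)
  consider "v \<in> inside (poly_boundary P)" | i where "i < length P" "v = pv P i"
    | i where "i < length P" "v \<in> pedge P i" "v \<noteq> pv P i" "v \<noteq> pv P (Suc i)"
  proof -
    have "\<exists>j<length P. pv P k = pv P j" for k
      using P pv_mod[of P k] unfolding simple_polygon_def
      by (metis mod_less_divisor not_numeral_le_zero gr0I)
    then show ?thesis using vP that by (auto simp: poly_region_def poly_boundary_def)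
  qed
  then show False
  proof cases
    case 1
    have all: "\<forall>\<^sub>F t in at_right 0. v + of_real t * n \<in> poly_region P" for n
    proof -
      have "((\<lambda>t::real. v + of_real t * n) \<longlongrightarrow> v) (at_right 0)"
        by (rule tendsto_eq_intros refl | simp)+
      then have "\<forall>\<^sub>F t in at_right 0. v + of_real t * n \<in> inside (poly_boundary P)"
        using poly_Jordan(4)[OF P] 1 by (rule topological_tendstoD)
      then show ?thesis by (rule eventually_mono) (simp add: poly_region_def)
    qed
    show False by (rule no_opp[OF one_neq_zero all all])
  next
    case (3 i)
    let ?a = "pv P i" and ?b = "pv P (Suc i)"
    obtain s where s: "0 \<le> s" "s \<le> 1" "v = (1 - s) *\<^sub>R ?a + s *\<^sub>R ?b"
      using 3(2) unfolding pedge_def in_segment by blast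
    have s': "0 < s" "s < 1" using s 3(3,4) by (cases "s = 0"; cases "s = 1"; auto)+
    have vs: "closed_segment v ?b \<subseteq> pedge P i" "closed_segment v ?a \<subseteq> pedge P i"
      using 3(2) unfolding pedge_def by (simp_all add: closed_segment_subset)
    \<comment> \<open>The ends of the edge are reached from \<open>v\<close> after parameters
      \<open>1 - s\<close> and \<open>s\<close>, so the edge covers both opposite directions near
      \<open>v\<close>.\<close>
    have e: "v + of_real (1 - s) * (?b - ?a) = ?b" "v + of_real s * (- (?b - ?a)) = ?a"
      unfolding s(3) by (simp_all add: scaleR_conv_of_real algebra_simps)
    have "0 < 1 - s" using s' by simp
    show False
      by (rule no_opp[of "?b - ?a", OF _ along[where s = "1 - s", OF 3(1) _ \<open>0 < 1 - s\<close>] along[where s = s, OF 3(1) _ s'(1)]])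
        (use pv_Suc_neq[OF P, of i] vs in \<open>simp_all only: e right_minus_eq not_False_eq_True\<close>)
  next
    case (2 i)
    define u where "u = corner_first P i"
    define w where "w = corner_last P i"
    note cs = corner_sector[OF P 2(1), folded 2(2) u_def w_def]
    have \<beta>: "interior_angle P i = Arg2pi (w / u)" by (simp add: interior_angle_eq u_def w_def)
    obtain j k where jk: "j < length P" "k < length P" "closed_segment v (v + u) = pedge P j"
      "closed_segment v (v + w) = pedge P k"
      using corner_edges[OF P 2(1)] unfolding u_def w_def 2(2) by metis
    have eu: "\<forall>\<^sub>F t in at_right 0. v + of_real t * u \<in> poly_region P"
      using along[OF jk(1), of 1 u] jk(3) by simp
    have ew: "\<forall>\<^sub>F t in at_right 0. v + of_real t * w \<in> poly_region P"
      using along[OF jk(2), of 1 w] jk(4) by simp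
    show False
    proof (cases "interior_angle P i \<le> pi")
      case True
      then show False using no[OF cs(1,2) eu ew] angP[OF 2(1)] pi_gt_zero unfolding \<beta> by linarith
    next
      case False
      \<comment> \<open>The opposite of \<open>u\<close> is at angle \<open>pi\<close>, strictly
        inside the reflex sector.\<close>
      have "\<forall>\<^sub>F t in at_right 0. v + of_real t * (- u) \<in> inside (poly_boundary P)"
        using cs(1) opp[OF cs(1)] False by (intro cs(4)) auto
      then have "\<forall>\<^sub>F t in at_right 0. v + of_real t * (- u) \<in> poly_region P"
        by (rule eventually_mono) (simp add: poly_region_def)
      then show False by (rule no_opp[OF cs(1) eu])
    qed
  qed
qed

text \<open>If there are fewer quadrilaterals than edges, the bound follows from having at least two
  quadrilaterals. If the numbers agree, angles below \<open>2 * pi / 3\<close> add up to at least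
  \<open>2 * pi\<close>, so there are at least four.\<close>

lemma mesh_vertex_degree:
  assumes P: "simple_polygon P" and angP: "\<And>i. i < length P \<Longrightarrow> 2 * pi / 3 \<le> interior_angle P i"
    and angM: "\<And>q i. q \<in> M \<Longrightarrow> i < 4 \<Longrightarrow> interior_angle q i < 2 * pi / 3"
    and v: "v \<in> mesh_vertices"
  shows "card (quads_at v) + 4 \<le> 2 * card (edges_at v)"
proof (cases "card (quads_at v) = card (edges_at v)")
  case False
  then show ?thesis using two_quads_at[OF assms] quads_at_le_edges_at[of v] by linarith
next
  case True
  have ne: "quads_at v \<noteq> {}" using v by (auto simp: mesh_vertices_def quads_at_def)
  have "2 * pi \<le> (\<Sum>q\<in>quads_at v. Arg2pi (last_dir v q / first_dir v q))"
    by (rule full_angle[OF True ne])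
  also have "\<dots> < (\<Sum>q\<in>quads_at v. 2 * pi / 3)"
  proof (rule sum_strict_mono[OF finite_at(1) ne])
    fix q assume q: "q \<in> quads_at v"
    then have "q \<in> M" by (simp add: quads_at_def)
    then show "Arg2pi (last_dir v q / first_dir v q) < 2 * pi / 3"
      unfolding quad_corner(6)[OF q] using angM corner_index(1)[OF q] by blast
  qed
  finally have "3 * pi < real (card (quads_at v)) * pi" by simp
  then have "3 < card (quads_at v)" by simp
  then show ?thesis using True by linarith
qed

section \<open>Double counting over the mesh vertices\<close>

lemma sum_quads_at: "(\<Sum>v\<in>mesh_vertices. card (quads_at v)) = 4 * card M"
proof -
  have "(\<Sum>v\<in>mesh_vertices. card (quads_at v)) = (\<Sum>v\<in>mesh_vertices. \<Sum>q\<in>M. of_bool (v \<in> set q))"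
    using mesh_finite by (intro sum.cong refl) (simp only: sum_of_bool_eq quads_at_def Int_def of_nat_id mem_Collect_eq)
  also have "\<dots> = (\<Sum>q\<in>M. \<Sum>v\<in>mesh_vertices. of_bool (v \<in> set q))" by (rule sum.swap)
  also have "\<dots> = (\<Sum>q\<in>M. 4)"
  proof (rule sum.cong[OF refl])
    fix q assume q: "q \<in> M"
    then have "mesh_vertices \<inter> {v. v \<in> set q} = set q" by (auto simp: mesh_vertices_def)
    moreover have "card (set q) = 4"
      using mesh_quad[OF q] by (simp add: simple_polygon_def distinct_card)
    ultimately show "(\<Sum>v\<in>mesh_vertices. of_bool (v \<in> set q)) = (4::nat)"
      using finite_mesh_vertices by (simp only: sum_of_bool_eq of_nat_id)
  qed
  finally show ?thesis by simp
qed

lemma sum_edges_at: "(\<Sum>v\<in>mesh_vertices. card (edges_at v)) = 2 * card mesh_edges"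
proof -
  have "(\<Sum>v\<in>mesh_vertices. card (edges_at v)) =
      (\<Sum>v\<in>mesh_vertices. \<Sum>e\<in>mesh_edges. of_bool (v = src e \<or> v = tgt e))"
    using finite_mesh_edges by (intro sum.cong refl) (simp only: sum_of_bool_eq edges_at_def Int_def of_nat_id mem_Collect_eq)
  also have "\<dots> = (\<Sum>e\<in>mesh_edges. \<Sum>v\<in>mesh_vertices. of_bool (v = src e \<or> v = tgt e))" by (rule sum.swap)
  also have "\<dots> = (\<Sum>e\<in>mesh_edges. 2)"
  proof (rule sum.cong[OF refl])
    fix e assume e: "e \<in> mesh_edges"
    then have "mesh_vertices \<inter> {v. v = src e \<or> v = tgt e} = {src e, tgt e}"
      using mesh_edge(3,4)[OF e] by auto
    then show "(\<Sum>v\<in>mesh_vertices. of_bool (v = src e \<or> v = tgt e)) = (2::nat)"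
      using finite_mesh_vertices mesh_edge(2)[OF e] by (simp only: sum_of_bool_eq of_nat_id) simp
  qed
  finally show ?thesis by simp
qed

text \<open>In the sum of the degree bounds every quadrilateral is counted four times, and every
  edge four times as well: twice by its ends, doubled by the factor 2. The result contradicts
  \<open>mesh_Euler\<close>.\<close>

lemma mesh_angles_not_all_small:
  assumes P: "simple_polygon P" and angP: "\<And>i. i < length P \<Longrightarrow> 2 * pi / 3 \<le> interior_angle P i"
    and angM: "\<And>q i. q \<in> M \<Longrightarrow> i < 4 \<Longrightarrow> interior_angle q i < 2 * pi / 3"
  shows False
proof -
  have "(\<Sum>v\<in>mesh_vertices. card (quads_at v) + 4) \<le> (\<Sum>v\<in>mesh_vertices. 2 * card (edges_at v))"
    using mesh_vertex_degree[OF assms] by (intro sum_mono) blast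
  then have "4 * card M + 4 * card mesh_vertices \<le> 4 * card mesh_edges"
    by (simp add: sum.distrib sum_quads_at sum_edges_at flip: sum_distrib_left)
  then show False using mesh_Euler[OF P] by simp
qed

end

theorem theorem5:
  fixes P :: "complex list"
  assumes "simple_polygon P"
    and "\<forall>i < length P. interior_angle P i \<ge> 2 * pi / 3"
  shows "\<not> (\<exists>M. quad_mesh P M \<and>
              (\<forall>q \<in> M. \<forall>i < 4. interior_angle q i < 2 * pi / 3))"
proof
  assume "\<exists>M. quad_mesh P M \<and> (\<forall>q \<in> M. \<forall>i < 4. interior_angle q i < 2 * pi / 3)"
  then obtain M where M: "quad_mesh P M" "\<forall>q \<in> M. \<forall>i < 4. interior_angle q i < 2 * pi / 3"
    by blast
  interpret polygon_mesh P M by unfold_locales (rule M(1))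
  show False using mesh_angles_not_all_small[OF assms(1)] assms(2) M(2) by blast
qed

end
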